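(* Let $w_0>0$. Assume $\mathscr S^{*}\neq\varnothing$, that $U$ satisfies the utility assumption, and that we are in the positive-wealth setting. If $U(+\infty):=\lim_{x\to+\infty}U(x)<+\infty$, then there exists $\hat\phi\in\mathcal A(w_0)$ such that $$u(w_0)=\inf_{S\in\mathscr S}\mathbb E_{\mathbb P}\big[U(W_T^S(w_0,\hat\phi))\big]<+\infty.$$
   Context: Fix $d,T\in\mathbb N$ and a filtered probability space $(\Omega,\mathcal F,\mathbb F=(\mathcal F_t)_{t=0}^T,\mathbb P)$ whose $\sigma$-algebras all contain the $\mathbb P$-null sets; random variables equal a.s. are identified. For $\mathcal G\subseteq\mathcal F$, $L^0(\mathcal G;\mathbb R^n)$ is the space of $\mathcal G$-measurable $\mathbb R^n$-valued random variables with the topology of convergence in probability. Let $\mathscr S$ be a nonempty family of $\mathbb F$-adapted $\mathbb R^d$-valued processes $S=(S_t)_{t=0}^T$, and write $\Delta S_t=S_t-S_{t-1}$. Let $\mathscr L=\prod_{t=1}^T L^0(\mathcal F_{t-1};\mathbb R^d)$. For $w\in\mathbb R$, $\phi\in\mathscr L$, $S\in\mathscr S$, set $W_t^S(w,\phi)=w+\sum_{s=1}^t\langle\phi_s,\Delta S_s\rangle$. For $S\in\mathscr S$ and $t\ge1$, $D_t^S(\omega)$ is the smallest affine subspace of $\mathbb R^d$ containing the support of the regular conditional distribution of $\Delta S_t$ given $\mathcal F_{t-1}$ at $\omega$. NA($S$) means: for every $\phi\in\mathscr L$, $W_T^S(0,\phi)\ge0$ a.s. implies $W_T^S(0,\phi)=0$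 a.s. $\mathscr S^{*}$ denotes the set of $S^*\in\mathscr S$ such that NA($S^*$) holds and, for every $S\in\mathscr S$ and $t$, $D_t^S\subseteq D_t^{S^*}$ a.s. Utility assumption: $U:\mathbb R\to\mathbb R\cup\{-\infty\}$ is non-decreasing, concave and upper semicontinuous. Positive-wealth setting: for every $S\in\mathscr S$, $\mathscr L(w_0,S)=\{\phi\in\mathscr L: W_t^S(w_0,\phi)\ge0\ \text{a.s. for all }t\in\{0,\ldots,T\}\}$, and the interior of $\{x:U(x)>-\infty\}$ is $(0,+\infty)$. Admissible set $\mathcal A(w_0)=\bigcap_{S\in\mathscr S}\mathscr L(w_0,S)$; value $u(w_0)=\sup_{\varphi\in\mathcal A(w_0)}\inf_{S\in\mathscr S}\mathbb E_{\mathbb P}[U(W_T^S(w_0,\varphi))]$, with the convention that the expectation of a random variable whose positive and negative parts both have infinite expectation is $-\infty$. *)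

theory Defs
  imports "HOL-Probability.Probability"
begin

text \<open>Processes: S :: nat => 'w => 'v, with 'v a Euclidean space (R^d, d = DIM('v)).
  Filtration: F :: nat => 'w measure (F t is the sigma-algebra at time t).\<close>

definition strategies :: "(nat \<Rightarrow> 'w measure) \<Rightarrow> nat \<Rightarrow> (nat \<Rightarrow> 'w \<Rightarrow> 'v::euclidean_space) set" where
  "strategies F T = {\<phi>. \<forall>s\<in>{1..T}. \<phi> s \<in> borel_measurable (F (s - 1))}"

definition wealth :: "(nat \<Rightarrow> 'w \<Rightarrow> 'v::euclidean_space) \<Rightarrow> real \<Rightarrow> (nat \<Rightarrow> 'w \<Rightarrow> 'v) \<Rightarrow> nat \<Rightarrow> 'w \<Rightarrow> real" where
  "wealth S w \<phi> t \<omega> = w + (\<Sum>s\<in>{1..t}. inner (\<phi> s \<omega>) (S s \<omega> - S (s - 1) \<omega>))"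

definition NA :: "'w measure \<Rightarrow> (nat \<Rightarrow> 'w measure) \<Rightarrow> nat \<Rightarrow> (nat \<Rightarrow> 'w \<Rightarrow> 'v::euclidean_space) \<Rightarrow> bool" where
  "NA M F T S \<longleftrightarrow> (\<forall>\<phi>\<in>strategies F T.
      (AE \<omega> in M. wealth S 0 \<phi> T \<omega> \<ge> 0) \<longrightarrow> (AE \<omega> in M. wealth S 0 \<phi> T \<omega> = 0))"

definition is_rcd :: "'w measure \<Rightarrow> 'w measure \<Rightarrow> ('w \<Rightarrow> 'v::euclidean_space) \<Rightarrow> ('w \<Rightarrow> 'v measure) \<Rightarrow> bool" where
  "is_rcd M G X \<kappa> \<longleftrightarrow>
     (\<forall>\<omega>\<in>space M. prob_space (\<kappa> \<omega>) \<and> sets (\<kappa> \<omega>) = sets borel) \<and>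
     (\<forall>A\<in>sets borel. (\<lambda>\<omega>. emeasure (\<kappa> \<omega>) A) \<in> borel_measurable G) \<and>
     (\<forall>A\<in>sets borel. \<forall>B\<in>sets G.
        (\<integral>\<^sup>+\<omega>\<in>B. emeasure (\<kappa> \<omega>) A \<partial>M) = emeasure M (B \<inter> X -` A \<inter> space M))"

definition support_meas :: "'v::euclidean_space measure \<Rightarrow> 'v set" where
  "support_meas \<mu> = {x. \<forall>e>0. emeasure \<mu> (ball x e) > 0}"

definition Dset :: "'w measure \<Rightarrow> (nat \<Rightarrow> 'w measure) \<Rightarrow> (nat \<Rightarrow> 'w \<Rightarrow> 'v::euclidean_space) \<Rightarrow> nat \<Rightarrow> 'w \<Rightarrow> 'v set" where
  "Dset M F S t \<omega> =
     affine hull (support_meas ((SOME \<kappa>. is_rcd M (F (t - 1)) (\<lambda>\<omega>. S t \<omega> - S (t - 1) \<omega>) \<kappa>) \<omega>))"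

definition Sstar :: "'w measure \<Rightarrow> (nat \<Rightarrow> 'w measure) \<Rightarrow> nat \<Rightarrow> (nat \<Rightarrow> 'w \<Rightarrow> 'v::euclidean_space) set \<Rightarrow> (nat \<Rightarrow> 'w \<Rightarrow> 'v) set" where
  "Sstar M F T SS = {S'\<in>SS. NA M F T S' \<and>
      (\<forall>S\<in>SS. \<forall>t\<in>{1..T}. AE \<omega> in M. Dset M F S t \<omega> \<subseteq> Dset M F S' t \<omega>)}"

definition Lpos :: "'w measure \<Rightarrow> (nat \<Rightarrow> 'w measure) \<Rightarrow> nat \<Rightarrow> real \<Rightarrow> (nat \<Rightarrow> 'w \<Rightarrow> 'v::euclidean_space) \<Rightarrow> (nat \<Rightarrow> 'w \<Rightarrow> 'v) set" where
  "Lpos M F T w0 S = {\<phi>\<in>strategies F T. \<forall>t\<in>{0..T}. AE \<omega> in M. wealth S w0 \<phi> t \<omega> \<ge> 0}"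

definition Adm :: "'w measure \<Rightarrow> (nat \<Rightarrow> 'w measure) \<Rightarrow> nat \<Rightarrow> (nat \<Rightarrow> 'w \<Rightarrow> 'v::euclidean_space) set \<Rightarrow> real \<Rightarrow> (nat \<Rightarrow> 'w \<Rightarrow> 'v) set" where
  "Adm M F T SS w0 = (\<Inter>S\<in>SS. Lpos M F T w0 S)"

text \<open>Extended expectation of an extended-real random variable: E[X^+] - E[X^-],
  with the convention that it is -infinity when both parts have infinite expectation.\<close>
definition eexp :: "'w measure \<Rightarrow> ('w \<Rightarrow> ereal) \<Rightarrow> ereal" where
  "eexp M X =
     (let p = enn2ereal (\<integral>\<^sup>+\<omega>. e2ennreal (X \<omega>) \<partial>M);
          n = enn2ereal (\<integral>\<^sup>+\<omega>. e2ennreal (- X \<omega>) \<partial>M)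
      in if p = \<infinity> \<and> n = \<infinity> then - \<infinity> else p - n)"

definition uval :: "'w measure \<Rightarrow> (nat \<Rightarrow> 'w measure) \<Rightarrow> nat \<Rightarrow> (nat \<Rightarrow> 'w \<Rightarrow> 'v::euclidean_space) set \<Rightarrow> (real \<Rightarrow> ereal) \<Rightarrow> real \<Rightarrow> ereal" where
  "uval M F T SS U w0 =
     (SUP \<phi>\<in>Adm M F T SS w0. INF S\<in>SS. eexp M (\<lambda>\<omega>. U (wealth S w0 \<phi> T \<omega>)))"

definition utility :: "(real \<Rightarrow> ereal) \<Rightarrow> bool" where
  "utility U \<longleftrightarrow> (\<forall>x. U x \<noteq> \<infinity>) \<and> mono U \<and>
     (\<forall>x y l. 0 < l \<and> l < 1 \<longrightarrow> ereal l * U x + ereal (1 - l) * U y \<le> U (l * x + (1 - l) * y)) \<and>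
     (\<forall>x. Limsup (at x) U \<le> U x)"

end

theory Submission
  imports Defs
begin

text \<open>
  Since \<open>U\<close> is bounded above by some \<open>L\<close>, maximising expected utility means minimising the worst-case
  integral of the convex, lower semicontinuous, \<open>[0, \<infinity>]\<close>-valued function \<open>V = L - U\<close>.
  Fix \<open>R\<close> in \<open>Sstar\<close>. A position that is orthogonal to the increment of \<open>R\<close> is orthogonal to the affine hull
  of its conditional support, hence by domination also to the increment of every other model; so
  positions may be replaced by their components orthogonal to all such null positions without
  changing the wealth in any model. By no-arbitrage for \<open>R\<close> and nonnegativity of wealth,
  a sequence of such reduced strategies is almost surely bounded, one period after the other.
  Near-minimisers then form convex sets in a weighted \<open>L\<^sup>2\<close>-space, where elements of almost minimal norm
  converge almost surely, and Fatou's lemma shows that the limit is optimal.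
\<close>

section \<open>Existence of regular conditional distributions\<close>

text \<open>\<open>Dset\<close> picks its conditional distribution with \<open>SOME\<close>, so
  domination carries no information until such a distribution is known to exist; hence the opening
  section. No measurable projection onto the random subspaces spanned by the conditional supports is
  ever built: they enter only through the equivalence between orthogonality to the increment and
  orthogonality to its conditional support, and projecting is done by minimising a weighted
  \<open>L\<^sup>2\<close> distance to the null positions. The same kind of minimisation serves
  three times: to project, to refute unboundedness, and to extract the optimal strategy. A weight is
  forced because the positions are bounded only by a random variable, which may fail to be
  integrable. Convergence is extracted for positions, not for wealths: the exceptional null set is
  then the same for every model, which is what permits an uncountable family of models.\<close>

lemma quaternary_series_bounds:
  fixes a :: "nat \<Rightarrow> bool"
  shows "summable (\<lambda>n. of_bool (a n) / 4 ^ Suc n :: real)"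
    and "0 \<le> (\<Sum>n. of_bool (a n) / 4 ^ Suc n :: real)"
    and "(\<Sum>n. of_bool (a n) / 4 ^ Suc n :: real) < 1"
proof -
  have g: "(\<lambda>n. (1/4) * (1/4) ^ n :: real) sums (1/4 * (1 / (1 - 1/4)))"
    by (intro sums_mult geometric_sums) auto
  have le: "of_bool (a n) / 4 ^ Suc n \<le> (1/4) * (1/4 :: real) ^ n" for n
    by (auto simp: power_divide divide_simps)
  show s: "summable (\<lambda>n. of_bool (a n) / 4 ^ Suc n :: real)"
    by (rule summable_comparison_test'[OF sums_summable[OF g], of 0]) (use le in auto)
  show "0 \<le> (\<Sum>n. of_bool (a n) / 4 ^ Suc n :: real)"
    by (rule suminf_nonneg[OF s]) auto
  have "(\<Sum>n. of_bool (a n) / 4 ^ Suc n :: real) \<le> (\<Sum>n. (1/4) * (1/4) ^ n)"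
    by (rule suminf_le[OF le s sums_summable[OF g]])
  also have "\<dots> = 1/3" using sums_unique[OF g] by simp
  finally show "(\<Sum>n. of_bool (a n) / 4 ^ Suc n :: real) < 1" by simp
qed

text \<open>Multiplying by \<open>4 ^ Suc n\<close> leaves an even integer from the earlier digits,
  which all keep a factor 4, then the digit \<open>a n\<close>, then a tail in [0, 1). The parity of
  the floor therefore reads off the digit. Using only the digits 0 and 1 in base 4 keeps the tail
  strictly below 1 and avoids the binary ambiguity 0.0111... = 0.1000....\<close>

lemma quaternary_digit:
  fixes a :: "nat \<Rightarrow> bool"
  shows "odd \<lfloor>4 ^ Suc n * (\<Sum>k. of_bool (a k) / 4 ^ Suc k :: real)\<rfloor> \<longleftrightarrow> a n"
proof -
  define t :: real where "t = (\<Sum>k. of_bool (a (k + Suc n)) / 4 ^ Suc k)"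
  define m :: int where "m = (\<Sum>k<n. of_bool (a k) * 4 ^ (n - k))"
  have "(\<Sum>k. of_bool (a k) / 4 ^ Suc k :: real) =
      (\<Sum>k. of_bool (a (k + Suc n)) / 4 ^ Suc (k + Suc n)) + (\<Sum>k<Suc n. of_bool (a k) / 4 ^ Suc k)"
    by (rule suminf_split_initial_segment[OF quaternary_series_bounds(1)])
  moreover have "4 ^ Suc n * (\<Sum>k. of_bool (a (k + Suc n)) / 4 ^ Suc (k + Suc n)) = t"
  proof -
    have "(\<lambda>k. of_bool (a (k + Suc n)) / 4 ^ Suc (k + Suc n) :: real)
        = (\<lambda>k. (1 / 4 ^ Suc n) * (of_bool (a (k + Suc n)) / 4 ^ Suc k))"
      by (auto simp: fun_eq_iff power_add)
    then show ?thesis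
      unfolding t_def
      using suminf_mult[OF quaternary_series_bounds(1)[of "\<lambda>k. a (k + Suc n)"], of "1 / 4 ^ Suc n"]
      by simp
  qed
  moreover have "4 ^ Suc n * (\<Sum>k<Suc n. of_bool (a k) / 4 ^ Suc k :: real) = of_int (m + of_bool (a n))"
  proof -
    have "4 ^ Suc n * (of_bool (a k) / 4 ^ Suc k :: real) = of_bool (a k) * 4 ^ (n - k)" if "k < n" for k
      using that by (simp add: power_diff)
    then have "4 ^ Suc n * (\<Sum>k<n. of_bool (a k) / 4 ^ Suc k :: real) = of_int m"
      unfolding m_def sum_distrib_left by simp
    then show ?thesis by (simp add: distrib_left)
  qed
  ultimately have "4 ^ Suc n * (\<Sum>k. of_bool (a k) / 4 ^ Suc k :: real) = of_int (m + of_bool (a n)) + t"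
    by (simp only: distrib_left)
  moreover have "0 \<le> t" "t < 1"
    unfolding t_def using quaternary_series_bounds(2,3)[of "\<lambda>k. a (k + Suc n)"] by auto
  ultimately have "\<lfloor>4 ^ Suc n * (\<Sum>k. of_bool (a k) / 4 ^ Suc k :: real)\<rfloor> = m + of_bool (a n)"
    by (intro floor_unique) auto
  moreover have "even m" unfolding m_def by (intro dvd_sum) auto
  ultimately show ?thesis by auto
qed

text \<open>Rationals are dense below \<open>x\<close>. Indices that fail the test contribute
  \<open>-\<infinity>\<close>, which is neutral for the supremum, so the index set stays fixed and
  countable while \<open>x\<close> varies; this makes the decoding map below measurable.\<close>

lemma ereal_SUP_rational_below:
  fixes x :: real and q :: "nat \<Rightarrow> real"
  assumes "\<And>r. r \<in> \<rat> \<Longrightarrow> \<exists>n. P n \<and> q n = r"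
  shows "(SUP n. if P n \<and> q n < x then ereal (q n) else -\<infinity>) = ereal x"
proof (rule antisym)
  show "(SUP n. if P n \<and> q n < x then ereal (q n) else -\<infinity>) \<le> ereal x"
    by (rule SUP_least) auto
  show "ereal x \<le> (SUP n. if P n \<and> q n < x then ereal (q n) else -\<infinity>)"
  proof (rule dense_le)
    fix y assume "y < ereal x"
    then obtain z :: real where z: "y < ereal z" "z < x"
      using ereal_dense2[of y "ereal x"] by auto
    obtain r where r: "r \<in> \<rat>" "z < r" "r < x" using Rats_dense_in_real[OF z(2)] by auto
    then obtain n where n: "P n" "q n = r" using assms by blast
    have "y \<le> ereal r" using z r by (metis less_ereal.simps(1) order.strict_trans less_imp_le)
    also have "\<dots> = (if P n \<and> q n < x then ereal (q n) else -\<infinity>)" using n r by auto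
    also have "\<dots> \<le> (SUP n. if P n \<and> q n < x then ereal (q n) else -\<infinity>)" by (rule SUP_upper) auto
    finally show "y \<le> \<dots>" .
  qed
qed

text \<open>A point is determined by the rational cuts of its coordinates. The countably many
  answers to "is the rational below this coordinate?" are stored as quaternary digits of one real;
  \<open>g\<close> reads the digits and recovers each coordinate as the supremum of the rationals
  below it. This reduces conditional distributions of vectors to those of numbers in [0, 1].\<close>

lemma borel_embedding_unit_interval:
  obtains f :: "'v::euclidean_space \<Rightarrow> real" and g
  where "f \<in> borel_measurable borel" "g \<in> borel_measurable borel"
    "\<And>x. g (f x) = x" "\<And>x. 0 \<le> f x" "\<And>x. f x \<le> 1"
proof -
  define e where "e = from_nat_into ((Basis :: 'v set) \<times> (\<rat> :: real set))"
  have re: "range e = Basis \<times> \<rat>"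
    unfolding e_def using countable_SIGMA[OF countable_finite[OF finite_Basis] countable_rat]
    by (intro range_from_nat_into) auto
  define f where "f x = (\<Sum>n. of_bool (snd (e n) < x \<bullet> fst (e n)) / 4 ^ Suc n :: real)" for x :: 'v
  define g where "g y = (\<Sum>b\<in>Basis. real_of_ereal
      (SUP n. if fst (e n) = b \<and> odd \<lfloor>4 ^ Suc n * y\<rfloor> then ereal (snd (e n)) else -\<infinity>) *\<^sub>R b)" for y :: real
  have 1: "f \<in> borel_measurable borel"
    unfolding f_def by (intro borel_measurable_suminf) (auto simp: of_bool_def)
  have 2: "g \<in> borel_measurable borel"
    unfolding g_def by measurable
  have 3: "g (f x) = x" for x
  proof -
    have "real_of_ereal (SUP n. if fst (e n) = b \<and> odd \<lfloor>4 ^ Suc n * f x\<rfloor> then ereal (snd (e n)) else -\<infinity>) = x \<bullet> b"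
      if b: "b \<in> Basis" for b
    proof -
      have "(\<lambda>n. if fst (e n) = b \<and> odd \<lfloor>4 ^ Suc n * f x\<rfloor> then ereal (snd (e n)) else -\<infinity>)
         = (\<lambda>n. if fst (e n) = b \<and> snd (e n) < x \<bullet> b then ereal (snd (e n)) else -\<infinity>)"
        unfolding f_def quaternary_digit by (auto simp: fun_eq_iff)
      moreover have "\<exists>n. fst (e n) = b \<and> snd (e n) = r" if "r \<in> \<rat>" for r
        using re that b by (metis fst_conv snd_conv imageE mem_Sigma_iff)
      ultimately show ?thesis using ereal_SUP_rational_below[of "\<lambda>n. fst (e n) = b" "\<lambda>n. snd (e n)" "x \<bullet> b"]
        by (simp only: real_of_ereal.simps)
    qed
    then show ?thesis unfolding g_def by (simp add: euclidean_representation)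
  qed
  show ?thesis
    by (rule that[OF 1 2 3]; unfold f_def) (intro quaternary_series_bounds less_imp_le)+
qed

text \<open>This is the quantile transform: a conditional probability \<open>c\<close> reappears as
  the probability that a uniform variable is at most \<open>c\<close>.\<close>

lemma emeasure_uniform_Iic:
  "emeasure (uniform_measure lborel {0..1}) {u::real. ennreal u \<le> c} = min 1 c"
proof (cases "c \<ge> 1")
  case True
  then have "{0..1} \<inter> {u::real. ennreal u \<le> c} = {0..1}"
    by (auto intro!: order_trans[OF _ True] simp: ennreal_le_1)
  with True show ?thesis
    by (subst emeasure_uniform_measure) (auto simp: min_def ennreal_leI)
next
  case False
  then obtain r where r: "c = ennreal r" "0 \<le> r" "r < 1" by (cases c) auto
  then have "{0..1} \<inter> {u::real. ennreal u \<le> c} = {0..r}" by auto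
  with r False show ?thesis using divide_ennreal[of r 1]
    by (subst emeasure_uniform_measure) (auto simp: min_def)
qed

text \<open>The kernel is the law of a conditional quantile driven by an independent uniform
  variable. Being an image of a probability measure, it is a probability measure for every outcome,
  even where the chosen versions \<open>c q\<close> of the conditional probabilities of
  \<open>Y\<close> exceeding \<open>q\<close> are not monotone in \<open>q\<close>. The conditional
  probabilities are then matched on half-lines, which determine finite measures.\<close>

lemma exists_rcd_unit_interval:
  fixes Y :: "'w \<Rightarrow> real"
  assumes "prob_space M" and sub: "subalgebra M G" and Y[measurable]: "Y \<in> borel_measurable M"
    and Y01: "\<And>\<omega>. \<omega> \<in> space M \<Longrightarrow> 0 \<le> Y \<omega> \<and> Y \<omega> \<le> 1"
  shows "\<exists>\<kappa>. is_rcd M G Y \<kappa>"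
proof -
  interpret prob_space M by fact
  interpret finite_measure_subalgebra M G by unfold_locales fact
  define Uf :: "real measure" where "Uf = uniform_measure lborel {0..1}"
  interpret Uf: prob_space Uf unfolding Uf_def by (rule prob_space_uniform_measure) auto
  have [measurable_cong, simp]: "sets Uf = sets borel" by (simp add: Uf_def)
  have [simp]: "space Uf = UNIV" by (simp add: Uf_def)
  have GM: "f \<in> borel_measurable M" if "f \<in> borel_measurable G" for f :: "'w \<Rightarrow> ennreal"
    using measurable_from_subalg[OF sub that] .
  define c where "c q = nn_cond_exp M G (indicator {\<omega>\<in>space M. q < Y \<omega>})" for q
  have cG[measurable]: "c q \<in> borel_measurable G" for q
    unfolding c_def by (rule borel_measurable_nn_cond_exp)
  have cM[measurable]: "c q \<in> borel_measurable M" for q by (rule GM[OF cG])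
  have c_int: "(\<integral>\<^sup>+\<omega>\<in>B. c q \<omega> \<partial>M) = emeasure M (B \<inter> {\<omega>\<in>space M. q < Y \<omega>})" if B: "B \<in> sets G" for B q
  proof -
    have [measurable]: "B \<in> sets M" using B sub by (auto simp: subalgebra_def)
    have "(\<integral>\<^sup>+\<omega>. indicator B \<omega> * c q \<omega> \<partial>M) = (\<integral>\<^sup>+\<omega>. indicator B \<omega> * indicator {\<omega>\<in>space M. q < Y \<omega>} \<omega> \<partial>M)"
      unfolding c_def by (rule nn_cond_exp_intg) (use B in auto)
    also have "\<dots> = (\<integral>\<^sup>+\<omega>. indicator (B \<inter> {\<omega>\<in>space M. q < Y \<omega>}) \<omega> \<partial>M)"
      by (intro nn_integral_cong) (auto simp: indicator_def)
    also have "\<dots> = emeasure M (B \<inter> {\<omega>\<in>space M. q < Y \<omega>})" by simp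
    finally show ?thesis by (simp add: mult.commute)
  qed
  have c_mono: "AE \<omega> in M. c q \<omega> \<le> c x \<omega>" if "x \<le> q" for x q
    unfolding c_def by (rule nn_cond_exp_mono) (use that in \<open>auto split: split_indicator\<close>)
  have c_le1: "AE \<omega> in M. c q \<omega> \<le> 1" for q
  proof -
    have "AE \<omega> in M. c q \<omega> \<le> nn_cond_exp M G (\<lambda>_. 1) \<omega>"
      unfolding c_def by (rule nn_cond_exp_mono) (auto split: split_indicator)
    moreover have "AE \<omega> in M. nn_cond_exp M G (\<lambda>_. 1) \<omega> = 1"
      using nn_cond_exp_F_meas[OF borel_measurable_const[of 1]] by eventually_elim simp
    ultimately show ?thesis by eventually_elim simp
  qed
  define I :: "real set" where "I = \<rat> \<inter> {0..1}"
  have I: "countable I" "I \<noteq> {}" "0 \<in> I" by (auto simp: I_def countable_rat)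
  \<comment> \<open>Generalised inverse of the conditional tail function. The default 0 keeps the
    supremum inside [0, 1] when no \<open>q\<close> qualifies, and is harmless because
    \<open>Y\<close> is nonnegative.\<close>
  define Q where "Q \<omega> u = (SUP q\<in>I. if ennreal u \<le> c q \<omega> then q else 0)" for \<omega> u
  have bdd: "bdd_above ((\<lambda>q. if ennreal u \<le> c q \<omega> then q else 0) ` I)" for u \<omega>
    by (rule bdd_aboveI[of _ 1]) (auto simp: I_def)
  have Qm[measurable]: "(\<lambda>p. Q (fst p) (snd p)) \<in> borel_measurable (G \<Otimes>\<^sub>M Uf)"
    unfolding Q_def by (intro borel_measurable_cSUP I bdd) measurable
  have Q_less: "x < Q \<omega> u \<longleftrightarrow> (\<exists>q\<in>I. x < q \<and> ennreal u \<le> c q \<omega>)" if "0 \<le> x" for x \<omega> u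
    unfolding Q_def by (subst less_cSUP_iff[OF I(2) bdd]) (use that in \<open>auto split: if_splits\<close>)
  have Q_nonneg: "0 \<le> Q \<omega> u" for \<omega> u
    unfolding Q_def by (rule order_trans[OF _ cSUP_upper[OF I(3) bdd]]) auto
  have spG: "space G = space M" using sub by (simp add: subalgebra_def)
  have Qu[measurable]: "Q \<omega> \<in> borel_measurable borel" if "\<omega> \<in> space M" for \<omega>
  proof -
    have "(\<lambda>u. (\<lambda>p. Q (fst p) (snd p)) (\<omega>, u)) \<in> borel_measurable Uf"
      by (rule measurable_compose[OF _ Qm]) (use that in \<open>auto simp: spG\<close>)
    then show ?thesis by simp
  qed
  define \<kappa> where "\<kappa> \<omega> = distr Uf borel (Q \<omega>)" for \<omega>
  have \<kappa>_em: "emeasure (\<kappa> \<omega>) A = emeasure Uf (Q \<omega> -` A)" if "A \<in> sets borel" "\<omega> \<in> space M" for A \<omega>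
    unfolding \<kappa>_def using that by (subst emeasure_distr) auto
  have \<kappa>_pair: "emeasure (\<kappa> \<omega>) A = emeasure Uf (Pair \<omega> -` ((\<lambda>p. Q (fst p) (snd p)) -` A \<inter> space (G \<Otimes>\<^sub>M Uf)))"
    if "A \<in> sets borel" "\<omega> \<in> space M" for A \<omega>
    unfolding \<kappa>_em[OF that] by (rule arg_cong[where f="emeasure Uf"]) (use that in \<open>auto simp: space_pair_measure spG\<close>)
  have \<kappa>_meas[measurable]: "(\<lambda>\<omega>. emeasure (\<kappa> \<omega>) A) \<in> borel_measurable G" if A: "A \<in> sets borel" for A
  proof -
    have "(\<lambda>\<omega>. emeasure Uf (Pair \<omega> -` ((\<lambda>p. Q (fst p) (snd p)) -` A \<inter> space (G \<Otimes>\<^sub>M Uf)))) \<in> borel_measurable G"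
      by (rule Uf.measurable_emeasure_Pair) (use A in measurable)
    then show ?thesis by (rule measurable_cong[THEN iffD1, rotated]) (use A in \<open>auto simp: \<kappa>_pair spG\<close>)
  qed
  have \<kappa>_tail: "(\<integral>\<^sup>+\<omega>\<in>B. emeasure (\<kappa> \<omega>) {x<..} \<partial>M) = emeasure M (B \<inter> {\<omega>\<in>space M. x < Y \<omega>})"
    if B: "B \<in> sets G" for B x
  proof (cases "0 \<le> x")
    case False
    have BM[measurable]: "B \<in> sets M" using B sub by (auto simp: subalgebra_def)
    have "emeasure (\<kappa> \<omega>) {x<..} = 1" if "\<omega> \<in> space M" for \<omega>
    proof -
      have "Q \<omega> -` {x<..} = space Uf" 
        using False less_le_trans[OF _ Q_nonneg, of x \<omega>] by auto
      then show ?thesis using that Uf.emeasure_space_1 by (simp add: \<kappa>_em)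
    qed
    then have "(\<integral>\<^sup>+\<omega>\<in>B. emeasure (\<kappa> \<omega>) {x<..} \<partial>M) = (\<integral>\<^sup>+\<omega>\<in>B. 1 \<partial>M)"
      by (intro nn_integral_cong) auto
    moreover have "B \<inter> {\<omega>\<in>space M. x < Y \<omega>} = B"

    proof -
      have "x < Y \<omega>" if "\<omega> \<in> space M" for \<omega> using False Y01[OF that] by linarith
      then show ?thesis using sets.sets_into_space[OF BM] by auto
    qed
    ultimately show ?thesis by simp
  next
    case True
    have BM[measurable]: "B \<in> sets M" using B sub by (auto simp: subalgebra_def)
    have [measurable]: "(\<lambda>\<omega>. emeasure (\<kappa> \<omega>) {x<..}) \<in> borel_measurable M" by (rule GM) simp
    show ?thesis
    proof (rule antisym)
      \<comment> \<open>Upper bound: if the quantile exceeds \<open>x\<close>, some rational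
        \<open>q\<close> above \<open>x\<close> has \<open>u\<close> at most \<open>c q\<close>,
        hence at most \<open>c x\<close>. Countability of \<open>I\<close> gives one null set for
        all \<open>q\<close>.\<close>
      have "AE \<omega> in M. \<forall>q\<in>I. x < q \<longrightarrow> c q \<omega> \<le> c x \<omega>"
        using I(1) c_mono by (subst AE_ball_countable) auto
      then have "AE \<omega> in M. emeasure (\<kappa> \<omega>) {x<..} * indicator B \<omega> \<le> c x \<omega> * indicator B \<omega>"
        using c_le1[of x] AE_space
      proof eventually_elim
        case (elim \<omega>)
        have "emeasure Uf (Q \<omega> -` {x<..}) \<le> emeasure Uf {u. ennreal u \<le> c x \<omega>}"

        proof (rule emeasure_mono)
          show "Q \<omega> -` {x<..} \<subseteq> {u. ennreal u \<le> c x \<omega>}"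

          proof
            fix u assume "u \<in> Q \<omega> -` {x<..}"
            then obtain q where "q \<in> I" "x < q" "ennreal u \<le> c q \<omega>" using Q_less[OF True] by auto
            with elim(1) have "ennreal u \<le> c x \<omega>" by (meson order_trans)
            then show "u \<in> {u. ennreal u \<le> c x \<omega>}" by simp
          qed
          have "{u \<in> space borel. ennreal u \<le> c x \<omega>} \<in> sets borel" by measurable
          then show "{u. ennreal u \<le> c x \<omega>} \<in> sets Uf" by simp
        qed
        also have "\<dots> \<le> c x \<omega>" unfolding Uf_def emeasure_uniform_Iic by simp
        finally show ?case using elim by (auto simp: \<kappa>_em intro!: mult_right_mono)
      qed
      then show "(\<integral>\<^sup>+\<omega>\<in>B. emeasure (\<kappa> \<omega>) {x<..} \<partial>M) \<le> emeasure M (B \<inter> {\<omega>\<in>space M. x < Y \<omega>})"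
        unfolding c_int[OF B, symmetric] by (rule nn_integral_mono_AE)
    next
      \<comment> \<open>Lower bound: the comparison needs a rational strictly between
        \<open>x\<close> and the threshold, so the event that \<open>Y\<close> exceeds
        \<open>x\<close> is exhausted by thresholds \<open>x + 1 / Suc n\<close>. Thresholds of at
        least 1 give the empty event; below 1 the rational lies in \<open>I\<close>.\<close>
      define E where "E n = B \<inter> {\<omega>\<in>space M. x + 1 / Suc n < Y \<omega>}" for n
      have E_le: "emeasure M (E n) \<le> (\<integral>\<^sup>+\<omega>\<in>B. emeasure (\<kappa> \<omega>) {x<..} \<partial>M)" for n
      proof (cases "x + 1 / Suc n < 1")
        case False
        then have "E n = {}" unfolding E_def using Y01 by (auto dest: less_le_trans)
        then show ?thesis by simp
      next
        case lt: True
        obtain q where q: "q \<in> \<rat>" "x < q" "q < x + 1 / Suc n"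
          using Rats_dense_in_real[of x "x + 1 / Suc n"] by auto
        then have qI: "q \<in> I" using lt True by (auto simp: I_def)
        have "emeasure M (E n) \<le> emeasure M (B \<inter> {\<omega>\<in>space M. q < Y \<omega>})"
          by (rule emeasure_mono) (use q in \<open>auto simp: E_def\<close>)
        also have "\<dots> = (\<integral>\<^sup>+\<omega>\<in>B. c q \<omega> \<partial>M)" using c_int[OF B] by simp
        also have "\<dots> \<le> (\<integral>\<^sup>+\<omega>\<in>B. emeasure (\<kappa> \<omega>) {x<..} \<partial>M)"
        proof (rule nn_integral_mono_AE)
          show "AE \<omega> in M. c q \<omega> * indicator B \<omega> \<le> emeasure (\<kappa> \<omega>) {x<..} * indicator B \<omega>"
            using c_le1[of q] AE_space
          proof eventually_elim
            case (elim \<omega>)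
            have "c q \<omega> = emeasure Uf {u. ennreal u \<le> c q \<omega>}"
              unfolding Uf_def emeasure_uniform_Iic using elim by (simp add: min_def)
            also have "\<dots> \<le> emeasure Uf (Q \<omega> -` {x<..})"
            proof (rule emeasure_mono)
              show "{u. ennreal u \<le> c q \<omega>} \<subseteq> Q \<omega> -` {x<..}" using qI q by (auto simp: Q_less[OF True])
              show "Q \<omega> -` {x<..} \<in> sets Uf"
                using measurable_sets[OF Qu[OF elim(2)], of "{x<..}"] by simp
            qed
            finally show ?case using elim by (auto simp: \<kappa>_em intro!: mult_right_mono)
          qed
        qed
        finally show ?thesis .
      qed
      have "(SUP n. emeasure M (E n)) = emeasure M (\<Union>n. E n)"
      proof (rule SUP_emeasure_incseq)
        show "range E \<subseteq> sets M" by (auto simp: E_def)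
        show "incseq E"
        proof (rule incseq_SucI)
          fix n
          have "1 / real (Suc (Suc n)) \<le> 1 / real (Suc n)" by (simp add: field_simps)
          then show "E n \<subseteq> E (Suc n)" unfolding E_def by auto
        qed
      qed
      moreover have "(\<Union>n. E n) = B \<inter> {\<omega>\<in>space M. x < Y \<omega>}"
      proof -
        have "\<exists>n. x + 1 / Suc n < Y \<omega>" if "x < Y \<omega>" for \<omega>
          using reals_Archimedean[of "Y \<omega> - x"] that by (auto simp: field_simps)
        moreover have "x < Y \<omega>" if "x + 1 / real (Suc n) < Y \<omega>" for \<omega> n
          using that by (rule less_trans[rotated]) simp
        ultimately show ?thesis unfolding E_def by auto
      qed
      ultimately have "emeasure M (B \<inter> {\<omega>\<in>space M. x < Y \<omega>}) = (SUP n. emeasure M (E n))" by simp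
      also have "\<dots> \<le> (\<integral>\<^sup>+\<omega>\<in>B. emeasure (\<kappa> \<omega>) {x<..} \<partial>M)" by (rule SUP_least[OF E_le])
      finally show "emeasure M (B \<inter> {\<omega>\<in>space M. x < Y \<omega>}) \<le> (\<integral>\<^sup>+\<omega>\<in>B. emeasure (\<kappa> \<omega>) {x<..} \<partial>M)" .
    qed
  qed
  have \<kappa>_all: "(\<integral>\<^sup>+\<omega>\<in>B. emeasure (\<kappa> \<omega>) A \<partial>M) = emeasure M (B \<inter> Y -` A \<inter> space M)"
    if A: "A \<in> sets borel" and B: "B \<in> sets G" for A B
  proof -
    have BM[measurable]: "B \<in> sets M" using B sub by (auto simp: subalgebra_def)
    \<comment> \<open>For fixed \<open>B\<close> both sides are finite measures in \<open>A\<close>.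
      Writing the left one as an image of a product measure supplies its countable
      additivity.\<close>
    define \<nu>1 where "\<nu>1 = distr (density M (indicator B) \<Otimes>\<^sub>M Uf) borel (\<lambda>p. Q (fst p) (snd p))"
    define \<nu>2 where "\<nu>2 = distr (density M (indicator B)) borel Y"
    have "fst \<in> measurable (density M (indicator B) \<Otimes>\<^sub>M Uf) M" by simp
    then have "fst \<in> measurable (density M (indicator B) \<Otimes>\<^sub>M Uf) G"
      using sub sets.sets_into_space unfolding measurable_def subalgebra_def by (auto simp: space_pair_measure)
    then have idG: "(\<lambda>p. (fst p, snd p)) \<in> measurable (density M (indicator B) \<Otimes>\<^sub>M Uf) (G \<Otimes>\<^sub>M Uf)"
      by (intro measurable_Pair) auto
    have Qm'[measurable]: "(\<lambda>p. Q (fst p) (snd p)) \<in> borel_measurable (density M (indicator B) \<Otimes>\<^sub>M Uf)"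
      using measurable_compose[OF idG Qm] by simp
    have \<nu>1: "emeasure \<nu>1 A = (\<integral>\<^sup>+\<omega>\<in>B. emeasure (\<kappa> \<omega>) A \<partial>M)" if A: "A \<in> sets borel" for A
    proof -
      have [measurable]: "(\<lambda>\<omega>. emeasure (\<kappa> \<omega>) A) \<in> borel_measurable M" by (rule GM) (use A in simp)
      have "emeasure \<nu>1 A = emeasure (density M (indicator B) \<Otimes>\<^sub>M Uf)
          ((\<lambda>p. Q (fst p) (snd p)) -` A \<inter> space (density M (indicator B) \<Otimes>\<^sub>M Uf))"
        unfolding \<nu>1_def by (rule emeasure_distr) (use A in auto)
      also have "\<dots> = (\<integral>\<^sup>+\<omega>. emeasure Uf (Pair \<omega> -` ((\<lambda>p. Q (fst p) (snd p)) -` A \<inter> space (density M (indicator B) \<Otimes>\<^sub>M Uf)))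
          \<partial>density M (indicator B))"
        by (rule Uf.emeasure_pair_measure_alt) (use A in measurable)
      also have "\<dots> = (\<integral>\<^sup>+\<omega>. emeasure (\<kappa> \<omega>) A \<partial>density M (indicator B))"
        by (rule nn_integral_cong) (use A in \<open>auto simp: \<kappa>_pair space_pair_measure spG\<close>)
      also have "\<dots> = (\<integral>\<^sup>+\<omega>\<in>B. emeasure (\<kappa> \<omega>) A \<partial>M)"
        by (subst nn_integral_density) (auto simp: mult.commute)
      finally show ?thesis .
    qed
    have \<nu>2: "emeasure \<nu>2 A = emeasure M (B \<inter> Y -` A \<inter> space M)" if A: "A \<in> sets borel" for A
    proof -
      have [measurable]: "Y -` A \<inter> space M \<in> sets M" using A by measurable
      have "emeasure \<nu>2 A = emeasure (density M (indicator B)) (Y -` A \<inter> space M)"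
        unfolding \<nu>2_def using A by (subst emeasure_distr) auto
      also have "\<dots> = (\<integral>\<^sup>+\<omega>. indicator (B \<inter> Y -` A \<inter> space M) \<omega> \<partial>M)"
        by (subst emeasure_density) (auto intro!: nn_integral_cong simp: indicator_def)
      also have "\<dots> = emeasure M (B \<inter> Y -` A \<inter> space M)"
        by (rule nn_integral_indicator) (metis BM Int_assoc \<open>Y -` A \<inter> space M \<in> sets M\<close> sets.Int)
      finally show ?thesis .
    qed
    have "\<nu>1 = \<nu>2"
    proof (rule measure_eqI_lessThan)
      show "sets \<nu>1 = sets borel" "sets \<nu>2 = sets borel" by (auto simp: \<nu>1_def \<nu>2_def)
      show "emeasure \<nu>1 {x<..} = emeasure \<nu>2 {x<..}" for x
        by (simp add: \<nu>1 \<nu>2 \<kappa>_tail[OF B]) (auto intro!: arg_cong[where f="emeasure M"])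
      show "emeasure \<nu>1 {x<..} < \<infinity>" for x
        by (simp add: \<nu>1 \<kappa>_tail[OF B] less_top[symmetric])
    qed
    then show ?thesis using \<nu>1[OF A] \<nu>2[OF A] by simp
  qed
  have "is_rcd M G Y \<kappa>"
    unfolding is_rcd_def
  proof (intro conjI ballI)
    fix \<omega> assume "\<omega> \<in> space M"
    then show "prob_space (\<kappa> \<omega>)" unfolding \<kappa>_def by (intro Uf.prob_space_distr) simp
    show "sets (\<kappa> \<omega>) = sets borel" by (simp add: \<kappa>_def)
  qed (use \<kappa>_meas \<kappa>_all in auto)
  then show ?thesis by blast
qed

text \<open>Encode \<open>X\<close> into the unit interval, disintegrate there, and push the kernel
  back along the decoder: since \<open>g\<close> inverts \<open>f\<close> on the left,
  \<open>f (X \<omega>)\<close> lies in the preimage of \<open>A\<close> under \<open>g\<close>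
  exactly when \<open>X \<omega>\<close> lies in \<open>A\<close>.\<close>

lemma exists_rcd:
  fixes X :: "'w \<Rightarrow> 'v::euclidean_space"
  assumes P: "prob_space M" and sub: "subalgebra M G" and X[measurable]: "X \<in> borel_measurable M"
  shows "\<exists>\<kappa>. is_rcd M G X \<kappa>"
proof -
  obtain f :: "'v \<Rightarrow> real" and g where [measurable]: "f \<in> borel_measurable borel" "g \<in> borel_measurable borel"
    and gf: "\<And>x. g (f x) = x" and f01: "\<And>x. 0 \<le> f x" "\<And>x. f x \<le> 1"
    using borel_embedding_unit_interval by blast
  obtain \<kappa> where "is_rcd M G (\<lambda>\<omega>. f (X \<omega>)) \<kappa>"
    using exists_rcd_unit_interval[OF P sub, of "\<lambda>\<omega>. f (X \<omega>)"] f01 by auto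
  then have \<kappa>: "\<And>\<omega>. \<omega> \<in> space M \<Longrightarrow> prob_space (\<kappa> \<omega>)" "\<And>\<omega>. \<omega> \<in> space M \<Longrightarrow> sets (\<kappa> \<omega>) = sets borel"
    "\<And>A. A \<in> sets borel \<Longrightarrow> (\<lambda>\<omega>. emeasure (\<kappa> \<omega>) A) \<in> borel_measurable G"
    "\<And>A B. A \<in> sets borel \<Longrightarrow> B \<in> sets G \<Longrightarrow>
      (\<integral>\<^sup>+\<omega>\<in>B. emeasure (\<kappa> \<omega>) A \<partial>M) = emeasure M (B \<inter> (\<lambda>\<omega>. f (X \<omega>)) -` A \<inter> space M)"
    unfolding is_rcd_def by blast+
  have spG: "space G = space M" using sub by (simp add: subalgebra_def)
  have gm: "g \<in> measurable (\<kappa> \<omega>) borel" if "\<omega> \<in> space M" for \<omega>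
    using \<kappa>(2)[OF that] by (simp cong: measurable_cong_sets)
  have em: "emeasure (distr (\<kappa> \<omega>) borel g) A = emeasure (\<kappa> \<omega>) (g -` A)"
    if "A \<in> sets borel" "\<omega> \<in> space M" for A \<omega>
    using that sets_eq_imp_space_eq[OF \<kappa>(2)[OF that(2)]] by (subst emeasure_distr) (auto intro: gm)
  have gA: "g -` A \<in> sets borel" if "A \<in> sets borel" for A
    using measurable_sets[of g borel borel A] that by simp
  have "is_rcd M G X (\<lambda>\<omega>. distr (\<kappa> \<omega>) borel g)"
    unfolding is_rcd_def
  proof (intro conjI ballI)
    fix \<omega> assume "\<omega> \<in> space M"
    then show "prob_space (distr (\<kappa> \<omega>) borel g)" by (intro prob_space.prob_space_distr \<kappa> gm)
  next
    fix A :: "'v set" assume A: "A \<in> sets borel"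
    show "(\<lambda>\<omega>. emeasure (distr (\<kappa> \<omega>) borel g) A) \<in> borel_measurable G"
      by (rule measurable_cong[THEN iffD1, OF _ \<kappa>(3)[OF gA[OF A]]]) (use A em spG in auto)
    fix B assume B: "B \<in> sets G"
    have "(\<integral>\<^sup>+\<omega>\<in>B. emeasure (distr (\<kappa> \<omega>) borel g) A \<partial>M) = (\<integral>\<^sup>+\<omega>\<in>B. emeasure (\<kappa> \<omega>) (g -` A) \<partial>M)"
      by (rule nn_integral_cong) (use A em in auto)
    also have "\<dots> = emeasure M (B \<inter> (\<lambda>\<omega>. f (X \<omega>)) -` (g -` A) \<inter> space M)"
      by (rule \<kappa>(4)[OF gA[OF A] B])
    also have "(\<lambda>\<omega>. f (X \<omega>)) -` (g -` A) = X -` A" using gf by auto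
    finally show "(\<integral>\<^sup>+\<omega>\<in>B. emeasure (distr (\<kappa> \<omega>) borel g) A \<partial>M) = emeasure M (B \<inter> X -` A \<inter> space M)" .
  qed simp
  then show ?thesis by blast
qed

section \<open>Conditional supports and orthogonality\<close>

text \<open>Every point outside the support has a null ball around it, and by the Lindelof property
  countably many null balls cover the union of all of them.\<close>

lemma emeasure_outside_support:
  fixes \<mu> :: "'v::euclidean_space measure"
  assumes sets: "sets \<mu> = sets borel" and "open A" "A \<inter> support_meas \<mu> = {}"
  shows "emeasure \<mu> A = 0"
proof -
  define N where "N = {ball x e | x e. emeasure \<mu> (ball x e) = 0}"
  obtain N' where N': "N' \<subseteq> N" "countable N'" "\<Union>N' = \<Union>N"
    using Lindelof[of N] by (auto simp: N_def)
  have "N' \<subseteq> null_sets \<mu>"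
    using N'(1) sets by (auto simp: N_def null_sets_def)
  then have "\<Union>N' \<in> null_sets \<mu>"
    using N'(2) by (metis (no_types, lifting) UN_ball_bex_simps(1) null_sets_UN' image_ident subset_iff)
  moreover have "A \<subseteq> \<Union>N'"
  proof
    fix x assume "x \<in> A"
    then obtain e where "e > 0" "\<not> emeasure \<mu> (ball x e) > 0"
      using assms(3) unfolding support_meas_def disjoint_iff by blast
    then show "x \<in> \<Union>N'" 
      unfolding N'(3) by (intro UnionI[of "ball x e"]) (auto simp: N_def)
  qed
  moreover have "A \<in> sets \<mu>" using sets assms(2) by simp
  ultimately show ?thesis using null_sets_subset by blast
qed

text \<open>The hyperplane orthogonal to \<open>h\<close> is random, so it cannot be inserted into
  the kernel as a fixed Borel set. Its complement is exhausted by countably many fixed balls, and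
  the event that a given ball misses the hyperplane belongs to \<open>G\<close>; on that event the
  defining identity of the conditional distribution applies.\<close>

lemma rcd_support_orthogonal_iff:
  fixes X :: "'w \<Rightarrow> 'v::euclidean_space"
  assumes rcd: "is_rcd M G X \<kappa>" and sub: "subalgebra M G"
    and X[measurable]: "X \<in> borel_measurable M" and h[measurable]: "h \<in> borel_measurable G"
  shows "(AE \<omega> in M. h \<omega> \<bullet> X \<omega> = 0) \<longleftrightarrow> (AE \<omega> in M. support_meas (\<kappa> \<omega>) \<subseteq> {x. h \<omega> \<bullet> x = 0})"
proof -
  have \<kappa>: "\<And>\<omega>. \<omega> \<in> space M \<Longrightarrow> sets (\<kappa> \<omega>) = sets borel"
    "\<And>A. A \<in> sets borel \<Longrightarrow> (\<lambda>\<omega>. emeasure (\<kappa> \<omega>) A) \<in> borel_measurable G"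
    "\<And>A B. A \<in> sets borel \<Longrightarrow> B \<in> sets G \<Longrightarrow>
      (\<integral>\<^sup>+\<omega>\<in>B. emeasure (\<kappa> \<omega>) A \<partial>M) = emeasure M (B \<inter> X -` A \<inter> space M)"
    using rcd unfolding is_rcd_def by blast+
  have spG: "space G = space M" using sub by (simp add: subalgebra_def)
  obtain D :: "'v set" where D: "countable D" "\<And>Y. open Y \<Longrightarrow> Y \<noteq> {} \<Longrightarrow> \<exists>d\<in>D. d \<in> Y"
    using countable_dense_setE by blast
  \<comment> \<open>The distance of \<open>c\<close> from the hyperplane orthogonal to
    \<open>h \<omega>\<close> is at least \<open>r\<close>.\<close>
  define B where "B c r = {\<omega>\<in>space G. h \<omega> \<noteq> 0 \<and> r * norm (h \<omega>) \<le> \<bar>h \<omega> \<bullet> c\<bar>}" for c r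
  have BG: "B c r \<in> sets G" for c r unfolding B_def by measurable
  then have BM: "B c r \<in> sets M" for c r using sub by (auto simp: subalgebra_def)
  have B_off: "h \<omega> \<bullet> x \<noteq> 0" if "\<omega> \<in> B c r" "x \<in> ball c r" for \<omega> c r x
  proof
    assume 0: "h \<omega> \<bullet> x = 0"
    have "\<bar>h \<omega> \<bullet> c\<bar> = \<bar>h \<omega> \<bullet> (c - x)\<bar>" using 0 by (simp add: inner_diff_right)
    also have "\<dots> \<le> norm (h \<omega>) * norm (c - x)" by (rule Cauchy_Schwarz_ineq2)
    also have "\<dots> < norm (h \<omega>) * r" using that by (auto simp: B_def dist_norm)
    finally show False using that by (simp add: B_def mult.commute)
  qed
  have B_cover: "\<exists>c\<in>D. \<exists>r\<in>\<rat>. \<omega> \<in> B c r \<and> x \<in> ball c r" if "\<omega> \<in> space M" "h \<omega> \<bullet> x \<noteq> 0" for \<omega> x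
  proof -
    have h0: "h \<omega> \<noteq> 0" using that by auto
    define \<delta> where "\<delta> = \<bar>h \<omega> \<bullet> x\<bar> / norm (h \<omega>)"
    have \<delta>: "\<delta> > 0" "\<bar>h \<omega> \<bullet> x\<bar> = \<delta> * norm (h \<omega>)" using that h0 by (auto simp: \<delta>_def)
    \<comment> \<open>Here \<open>\<delta>\<close> is the distance of \<open>x\<close> from the
      hyperplane. A centre within \<open>\<delta>/4\<close> of \<open>x\<close> keeps distance at
      least \<open>3\<delta>/4\<close>, so any radius between \<open>\<delta>/4\<close> and
      \<open>\<delta>/2\<close> catches \<open>x\<close> and still avoids the hyperplane.\<close>
    obtain c where c: "c \<in> D" "c \<in> ball x (\<delta>/4)" using D(2)[of "ball x (\<delta>/4)"] \<delta> by auto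
    obtain r where r: "r \<in> \<rat>" "\<delta>/4 < r" "r < \<delta>/2" using Rats_dense_in_real[of "\<delta>/4" "\<delta>/2"] \<delta> by auto
    have cx: "norm (c - x) < \<delta>/4" using c by (simp add: dist_norm norm_minus_commute)
    have "\<bar>h \<omega> \<bullet> (c - x)\<bar> \<le> norm (h \<omega>) * norm (c - x)" by (rule Cauchy_Schwarz_ineq2)
    also have "\<dots> \<le> norm (h \<omega>) * (\<delta>/4)" using cx by (intro mult_left_mono) auto
    finally have "\<bar>h \<omega> \<bullet> x\<bar> - norm (h \<omega>) * (\<delta>/4) \<le> \<bar>h \<omega> \<bullet> c\<bar>"
      unfolding inner_diff_right by linarith
    moreover have "r * norm (h \<omega>) \<le> (\<delta>/2) * norm (h \<omega>)" using r by (intro mult_right_mono) auto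
    moreover have "0 \<le> \<delta> * norm (h \<omega>)" using \<delta> by simp
    ultimately have "r * norm (h \<omega>) \<le> \<bar>h \<omega> \<bullet> c\<bar>" unfolding \<delta>(2) by (simp add: algebra_simps)
    moreover have "x \<in> ball c r" using cx r by (simp add: dist_norm)
    ultimately show ?thesis using c(1) r(1) h0 that by (auto simp: B_def spG)
  qed
  have iff: "(AE \<omega> in M. \<omega> \<in> B c r \<longrightarrow> emeasure (\<kappa> \<omega>) (ball c r) = 0)
      \<longleftrightarrow> (AE \<omega> in M. \<omega> \<in> B c r \<longrightarrow> X \<omega> \<notin> ball c r)" for c r
  proof -
    have [measurable]: "(\<lambda>\<omega>. emeasure (\<kappa> \<omega>) (ball c r)) \<in> borel_measurable M"
      by (rule measurable_from_subalg[OF sub \<kappa>(2)]) simp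
    note BM[measurable]
    have "(AE \<omega> in M. \<omega> \<in> B c r \<longrightarrow> emeasure (\<kappa> \<omega>) (ball c r) = 0) \<longleftrightarrow>
        (AE \<omega> in M. emeasure (\<kappa> \<omega>) (ball c r) * indicator (B c r) \<omega> = 0)"
      by (intro AE_cong) (auto simp: indicator_def)
    also have "\<dots> \<longleftrightarrow> (\<integral>\<^sup>+\<omega>\<in>B c r. emeasure (\<kappa> \<omega>) (ball c r) \<partial>M) = 0"
      by (subst nn_integral_0_iff_AE) auto
    also have "\<dots> \<longleftrightarrow> emeasure M (B c r \<inter> X -` ball c r \<inter> space M) = 0"
      by (subst \<kappa>(3)) (auto intro: BG)
    also have "\<dots> \<longleftrightarrow> (AE \<omega> in M. \<omega> \<in> B c r \<longrightarrow> X \<omega> \<notin> ball c r)"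
    proof (rule AE_iff_measurable[symmetric])
      show "B c r \<inter> X -` ball c r \<inter> space M \<in> sets M"
        using sets.Int[OF BM[of c r] measurable_sets[OF X, of "ball c r"]] by (simp add: Int_assoc)
    qed auto
    finally show ?thesis .
  qed
  show ?thesis
  proof
    assume "AE \<omega> in M. h \<omega> \<bullet> X \<omega> = 0"
    then have "AE \<omega> in M. \<omega> \<in> B c r \<longrightarrow> X \<omega> \<notin> ball c r" for c r
      by eventually_elim (use B_off in blast)
    then have p: "AE \<omega> in M. \<omega> \<in> B c r \<longrightarrow> emeasure (\<kappa> \<omega>) (ball c r) = 0" for c r
      unfolding iff .
    have "AE \<omega> in M. \<forall>c\<in>D. \<forall>r\<in>\<rat>. \<omega> \<in> B c r \<longrightarrow> emeasure (\<kappa> \<omega>) (ball c r) = 0"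
      by (intro AE_ball_countable' p D(1) countable_rat)
    then show "AE \<omega> in M. support_meas (\<kappa> \<omega>) \<subseteq> {x. h \<omega> \<bullet> x = 0}"
      using AE_space
    proof eventually_elim
      case (elim \<omega>)
      show ?case
      proof (rule ccontr)
        assume "\<not> ?thesis"
        then obtain x where x: "x \<in> support_meas (\<kappa> \<omega>)" "h \<omega> \<bullet> x \<noteq> 0" by auto
        obtain c r where cr: "c \<in> D" "r \<in> \<rat>" "\<omega> \<in> B c r" "x \<in> ball c r"
          using B_cover[OF elim(2) x(2)] by blast
        obtain e where e: "e > 0" "ball x e \<subseteq> ball c r" using openE[OF open_ball cr(4)] by blast
        have "emeasure (\<kappa> \<omega>) (ball x e) \<le> emeasure (\<kappa> \<omega>) (ball c r)"
          by (rule emeasure_mono[OF e(2)]) (simp add: \<kappa>(1)[OF elim(2)])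
        then show False using elim(1) cr x(1) e(1) by (auto simp: support_meas_def)
      qed
    qed
  next
    assume "AE \<omega> in M. support_meas (\<kappa> \<omega>) \<subseteq> {x. h \<omega> \<bullet> x = 0}"
    then have p: "AE \<omega> in M. \<omega> \<in> B c r \<longrightarrow> emeasure (\<kappa> \<omega>) (ball c r) = 0" for c r
      using AE_space
    proof eventually_elim
      case (elim \<omega>)
      show ?case
      proof
        assume "\<omega> \<in> B c r"
        then have "ball c r \<inter> support_meas (\<kappa> \<omega>) = {}" using B_off elim(1) by blast
        then show "emeasure (\<kappa> \<omega>) (ball c r) = 0"
          by (intro emeasure_outside_support \<kappa>(1)[OF elim(2)]) auto
      qed
    qed
    have "AE \<omega> in M. \<forall>c\<in>D. \<forall>r\<in>\<rat>. \<omega> \<in> B c r \<longrightarrow> X \<omega> \<notin> ball c r"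
      by (intro AE_ball_countable' p[unfolded iff] D(1) countable_rat)
    then show "AE \<omega> in M. h \<omega> \<bullet> X \<omega> = 0"
      using AE_space by eventually_elim (use B_cover in blast)
  qed
qed

lemma orthogonal_increment_transfer:
  fixes S S' :: "nat \<Rightarrow> 'w \<Rightarrow> 'v::euclidean_space"
  assumes P: "prob_space M" and sub: "subalgebra M (F (t - 1))"
    and S[measurable]: "S t \<in> borel_measurable M" "S (t - 1) \<in> borel_measurable M"
    and S'[measurable]: "S' t \<in> borel_measurable M" "S' (t - 1) \<in> borel_measurable M"
    and D: "AE \<omega> in M. Dset M F S t \<omega> \<subseteq> Dset M F S' t \<omega>"
    and h: "h \<in> borel_measurable (F (t - 1))"
    and orth: "AE \<omega> in M. h \<omega> \<bullet> (S' t \<omega> - S' (t - 1) \<omega>) = 0"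
  shows "AE \<omega> in M. h \<omega> \<bullet> (S t \<omega> - S (t - 1) \<omega>) = 0"
proof -
  \<comment> \<open>This is the very choice made inside \<open>Dset\<close>, so both affine hulls
    unfold to hulls of supports of genuine conditional distributions.\<close>
  define \<kappa> where "\<kappa> S = (SOME \<kappa>. is_rcd M (F (t - 1)) (\<lambda>\<omega>. S t \<omega> - S (t - 1) \<omega>) \<kappa>)"
    for S :: "nat \<Rightarrow> 'w \<Rightarrow> 'v"
  have \<kappa>: "is_rcd M (F (t - 1)) (\<lambda>\<omega>. R t \<omega> - R (t - 1) \<omega>) (\<kappa> R)"
    if [measurable]: "R t \<in> borel_measurable M" "R (t - 1) \<in> borel_measurable M" for R
    unfolding \<kappa>_def by (rule someI_ex[OF exists_rcd[OF P sub]]) measurable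
  have "AE \<omega> in M. support_meas (\<kappa> S' \<omega>) \<subseteq> {x. h \<omega> \<bullet> x = 0}"
    using rcd_support_orthogonal_iff[OF \<kappa>[OF S'] sub borel_measurable_diff[OF S'] h] orth by simp
  then have "AE \<omega> in M. support_meas (\<kappa> S \<omega>) \<subseteq> {x. h \<omega> \<bullet> x = 0}"
    using D
  proof eventually_elim
    case (elim \<omega>)
    have "affine {x. h \<omega> \<bullet> x = 0}" by (rule affine_hyperplane)
    with elim(1) have "Dset M F S' t \<omega> \<subseteq> {x. h \<omega> \<bullet> x = 0}"
      unfolding Dset_def \<kappa>_def[symmetric] by (rule hull_minimal)
    moreover have "support_meas (\<kappa> S \<omega>) \<subseteq> Dset M F S t \<omega>"
      unfolding Dset_def \<kappa>_def[symmetric] by (rule hull_subset)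
    ultimately show ?case using elim(2) by blast
  qed
  then show ?thesis using rcd_support_orthogonal_iff[OF \<kappa>[OF S] sub borel_measurable_diff[OF S] h] by simp
qed

section \<open>Almost surely convergent selections from convex sets\<close>

text \<open>The increments are dominated by a geometric series of ratio \<open>sqrt (1/2)\<close>,
  so they are absolutely summable.\<close>

lemma convergent_of_weighted_increments:
  fixes x :: "nat \<Rightarrow> 'v::banach"
  assumes "\<And>k. 2 ^ k * (norm (x (Suc k) - x k))\<^sup>2 \<le> B"
  shows "convergent x"
proof -
  define s :: real where "s = sqrt (1/2)"
  have s: "0 < s" "s < 1" "s\<^sup>2 = 1/2" by (auto simp: s_def)
  have B: "B \<ge> 0" using assms[of 0] by (auto intro: order_trans[rotated])
  have "norm (x (Suc k) - x k) \<le> sqrt B * s ^ k" for k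
  proof (rule power2_le_imp_le)
    have "(norm (x (Suc k) - x k))\<^sup>2 \<le> B / 2 ^ k"
      using assms[of k] by (simp add: field_simps)
    also have "\<dots> = (sqrt B * s ^ k)\<^sup>2"
      using B s(3) by (simp add: power_mult_distrib power_mult[symmetric] mult.commute[of k] power_divide)
        (simp add: power_mult power_divide s(3))
    finally show "(norm (x (Suc k) - x k))\<^sup>2 \<le> (sqrt B * s ^ k)\<^sup>2" .
  qed (use B s in auto)
  moreover have "summable (\<lambda>k. sqrt B * s ^ k)"
    by (intro summable_mult summable_geometric) (use s in auto)
  ultimately have "summable (\<lambda>k. x (Suc k) - x k)"
    by (rule summable_comparison_test'[of _ 0, rotated])
  then show ?thesis by (simp add: telescope_summable' summable_iff_convergent sum_lessThan_telescope convergent_diff_const_right_iff)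
qed

text \<open>The sets shrink but stay convex, so almost-minimisers of the \<open>L\<^sup>2\<close>-norm form a Cauchy sequence
  by the parallelogram law; this replaces Komlos-type subsequence principles.\<close>

lemma convergent_selection_L2:
  fixes C :: "nat \<Rightarrow> ('i \<Rightarrow> 'w \<Rightarrow> 'v::euclidean_space) set"
  defines "E \<equiv> \<lambda>M I f. \<integral>\<omega>. (\<Sum>i\<in>I. (norm (f i \<omega>))\<^sup>2) \<partial>M"
  assumes fin: "finite I"
    and dec: "\<And>n. C (Suc n) \<subseteq> C n"
    and mid: "\<And>n f g. f \<in> C n \<Longrightarrow> g \<in> C n \<Longrightarrow> (\<lambda>i \<omega>. (1/2) *\<^sub>R (f i \<omega> + g i \<omega>)) \<in> C n"
    and meas: "\<And>n f i. f \<in> C n \<Longrightarrow> i \<in> I \<Longrightarrow> f i \<in> borel_measurable M"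
    and sq: "\<And>n f i. f \<in> C n \<Longrightarrow> i \<in> I \<Longrightarrow> integrable M (\<lambda>\<omega>. (norm (f i \<omega>))\<^sup>2)"
    and bnd: "\<And>n. \<exists>f\<in>C n. E M I f \<le> B"
  obtains f where "\<And>n. f n \<in> C n" "AE \<omega> in M. \<forall>i\<in>I. convergent (\<lambda>n. f n i \<omega>)"
    "\<And>n g. (\<And>k. g \<in> C k) \<Longrightarrow> E M I (f n) \<le> E M I g + 1 / Suc n"
proof -
  define d where "d n = (INF f\<in>C n. E M I f)" for n
  have E0: "0 \<le> E M I f" for f unfolding E_def by (intro Bochner_Integration.integral_nonneg sum_nonneg) auto
  have bdd: "bdd_below (E M I ` C n)" for n by (rule bdd_belowI[of _ 0]) (use E0 in auto)
  have ne: "C n \<noteq> {}" for n using bnd[of n] by auto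
  have anti: "C m \<subseteq> C n" if "n \<le> m" for n m using that dec by (rule lift_Suc_antimono_le[rotated]) 
  have d_le: "d n \<le> E M I f" if "f \<in> C n" for f n unfolding d_def by (rule cINF_lower[OF bdd that])
  have d_mono: "d n \<le> d m" if "n \<le> m" for n m
    unfolding d_def by (rule cINF_superset_mono[OF ne bdd anti[OF that]]) auto
  have dB: "d n \<le> B" for n using bnd[of n] d_le by (auto intro: order_trans)
  have "\<exists>f\<in>C n. E M I f < d n + 1 / Suc n" for n
    using cINF_less_iff[OF ne[of n] bdd[of n], of "d n + 1 / Suc n"] by (simp add: d_def)
  then obtain f where fC: "\<And>n. f n \<in> C n" and fE: "\<And>n. E M I (f n) < d n + 1 / Suc n" by metis
  obtain D where D: "d \<longlonglongrightarrow> D" and dD: "\<And>n. d n \<le> D"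
    using incseq_convergent[of d B] dB d_mono by (auto simp: incseq_def)
  \<comment> \<open>Parallelogram bound for \<open>n \<le> m\<close>: the squared norms of
    \<open>f m\<close> and \<open>f n\<close> are below \<open>d m + 1 / Suc m\<close> and
    \<open>d n + 1 / Suc n\<close>, while their midpoint lies in \<open>C n\<close> and so has
    squared norm at least \<open>d n\<close>. With \<open>d m \<le> D\<close> this leaves
    \<open>2 * (D - d n) + 4 / Suc n\<close>.\<close>
  define \<epsilon> where "\<epsilon> n = 2 * (D - d n) + 4 * (1 / Suc n)" for n
  have \<epsilon>_lim: "\<epsilon> \<longlonglongrightarrow> 0"
  proof -
    have "\<epsilon> \<longlonglongrightarrow> 2 * (D - D) + 4 * 0"
      unfolding \<epsilon>_def by (intro tendsto_intros D LIMSEQ_Suc[OF lim_1_over_n])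
    then show ?thesis by simp
  qed
  have int: "integrable M (\<lambda>\<omega>. \<Sum>i\<in>I. (norm (f i \<omega>))\<^sup>2)" if "f \<in> C n" for f n
    using sq[OF that] by (intro Bochner_Integration.integrable_sum) auto
  have diff_int: "integrable M (\<lambda>\<omega>. \<Sum>i\<in>I. (norm (f i \<omega> - g i \<omega>))\<^sup>2)"
    and diff_E: "(\<integral>\<omega>. (\<Sum>i\<in>I. (norm (f i \<omega> - g i \<omega>))\<^sup>2) \<partial>M)
      = 2 * E M I f + 2 * E M I g - 4 * E M I (\<lambda>i \<omega>. (1/2) *\<^sub>R (f i \<omega> + g i \<omega>))"
    if fg: "f \<in> C n" "g \<in> C n" for f g n
  proof -
    have "(norm (a - b))\<^sup>2 = 2 * (norm a)\<^sup>2 + 2 * (norm b)\<^sup>2 - 4 * (norm ((1/2) *\<^sub>R (a + b)))\<^sup>2" for a b :: 'v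
      by (simp only: power2_norm_eq_inner) (simp add: algebra_simps inner_commute)
    then have eq: "(\<lambda>\<omega>. \<Sum>i\<in>I. (norm (f i \<omega> - g i \<omega>))\<^sup>2) = (\<lambda>\<omega>. 2 * (\<Sum>i\<in>I. (norm (f i \<omega>))\<^sup>2)
        + 2 * (\<Sum>i\<in>I. (norm (g i \<omega>))\<^sup>2) - 4 * (\<Sum>i\<in>I. (norm ((1/2) *\<^sub>R (f i \<omega> + g i \<omega>)))\<^sup>2))"
      by (simp only: sum_distrib_left sum.distrib[symmetric] sum_subtractf[symmetric])
    show "integrable M (\<lambda>\<omega>. \<Sum>i\<in>I. (norm (f i \<omega> - g i \<omega>))\<^sup>2)"
      unfolding eq using int[OF fg(1)] int[OF fg(2)] int[OF mid[OF fg]] by auto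
    show "(\<integral>\<omega>. (\<Sum>i\<in>I. (norm (f i \<omega> - g i \<omega>))\<^sup>2) \<partial>M)
      = 2 * E M I f + 2 * E M I g - 4 * E M I (\<lambda>i \<omega>. (1/2) *\<^sub>R (f i \<omega> + g i \<omega>))"
      unfolding eq E_def using int[OF fg(1)] int[OF fg(2)] int[OF mid[OF fg]]
      by (subst Bochner_Integration.integral_diff, simp, simp, subst Bochner_Integration.integral_add) auto
  qed
  have aux: "2 * x + 2 * y - 4 * z \<le> 2 * (D - b) + 4 * e2"
    if "e1 \<le> e2" "b \<le> z" "x < a + e1" "y < b + e2" "a \<le> D" for x y z a b e1 e2 :: real
    using that by argo
  have cauchy: "(\<integral>\<omega>. (\<Sum>i\<in>I. (norm (f m i \<omega> - f n i \<omega>))\<^sup>2) \<partial>M) \<le> \<epsilon> n" if "n \<le> m" for n m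
  proof -
    have fm: "f m \<in> C n" using fC[of m] anti[OF that] by auto
    have "1 / real (Suc m) \<le> 1 / real (Suc n)" using that by (simp add: field_simps)
    then have "2 * E M I (f m) + 2 * E M I (f n) - 4 * E M I (\<lambda>i \<omega>. (1/2) *\<^sub>R (f m i \<omega> + f n i \<omega>)) \<le> \<epsilon> n"

      unfolding \<epsilon>_def by (rule aux[OF _ d_le[OF mid[OF fm fC[of n]]] fE[of m] fE[of n] dD[of m]])
    then show ?thesis using diff_E[OF fm fC[of n]] by simp
  qed
  have "\<exists>m>n. \<epsilon> m \<le> (1/4) ^ k" for n k
  proof -
    have "\<forall>\<^sub>F m in sequentially. \<epsilon> m < (1/4) ^ k" by (rule order_tendstoD(2)[OF \<epsilon>_lim]) auto
    then obtain N where "\<And>m. m \<ge> N \<Longrightarrow> \<epsilon> m < (1/4) ^ k" by (auto simp: eventually_sequentially)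
    then show ?thesis by (intro exI[of _ "max N (Suc n)"]) (auto intro: less_imp_le)
  qed
  then obtain nx where nx: "\<And>n k. nx n k > n" "\<And>n k. \<epsilon> (nx n k) \<le> (1/4) ^ k" by metis
  \<comment> \<open>The rate \<open>(1/4) ^ k\<close> survives multiplication by
    \<open>2 ^ k\<close> with a summable remainder. Strict growth of \<open>r\<close> puts the
    \<open>n\<close>-th selected element into \<open>C n\<close> again.\<close>
  define r where "r = rec_nat (nx 0 0) (\<lambda>k n. nx n (Suc k))"
  have r_Suc: "r k < r (Suc k)" for k using nx(1) by (simp add: r_def)
  have r_eps: "\<epsilon> (r k) \<le> (1/4) ^ k" for k using nx(2)[of 0 0] by (cases k) (simp_all add: r_def nx(2) del: power_Suc)
  have r_mono: "strict_mono r" using r_Suc by (simp add: strict_mono_Suc_iff)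
  define g where "g k = f (r k)" for k
  define \<Delta> where "\<Delta> k \<omega> = (\<Sum>i\<in>I. (norm (g (Suc k) i \<omega> - g k i \<omega>))\<^sup>2)" for k \<omega>
  have \<Delta>0: "0 \<le> \<Delta> k \<omega>" for k \<omega> unfolding \<Delta>_def by (intro sum_nonneg) auto
  have \<Delta>int: "integrable M (\<Delta> k)" "(\<integral>\<omega>. \<Delta> k \<omega> \<partial>M) \<le> (1/4) ^ k" for k
  proof -
    have "f (r (Suc k)) \<in> C (r k)" using fC[of "r (Suc k)"] anti[OF less_imp_le[OF r_Suc[of k]]] by auto
    then show "integrable M (\<Delta> k)"
      unfolding \<Delta>_def g_def by (rule diff_int[OF _ fC])
    show "(\<integral>\<omega>. \<Delta> k \<omega> \<partial>M) \<le> (1/4) ^ k"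
      unfolding \<Delta>_def g_def using cauchy[OF less_imp_le[OF r_Suc[of k]]] r_eps[of k] by linarith
  qed
  have [measurable]: "\<Delta> k \<in> borel_measurable M" for k using \<Delta>int(1) by auto
  have "(\<integral>\<^sup>+\<omega>. (\<Sum>k. ennreal (2 ^ k * \<Delta> k \<omega>)) \<partial>M) = (\<Sum>k. \<integral>\<^sup>+\<omega>. ennreal (2 ^ k * \<Delta> k \<omega>) \<partial>M)"
    by (rule nn_integral_suminf) auto
  also have "\<dots> \<le> (\<Sum>k. ennreal ((1/2) ^ k))"
  proof (rule suminf_le)
    fix k
    have "(\<integral>\<^sup>+\<omega>. ennreal (2 ^ k * \<Delta> k \<omega>) \<partial>M) = ennreal (2 ^ k * (\<integral>\<omega>. \<Delta> k \<omega> \<partial>M))"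
      using \<Delta>int(1) \<Delta>0 by (subst nn_integral_eq_integral) auto
    also have "\<dots> \<le> ennreal (2 ^ k * (1/4) ^ k)"
      by (intro ennreal_leI mult_left_mono \<Delta>int) auto
    also have "2 ^ k * (1/4) ^ k = (1/2 :: real) ^ k" by (simp add: power_mult_distrib[symmetric])
    finally show "(\<integral>\<^sup>+\<omega>. ennreal (2 ^ k * \<Delta> k \<omega>) \<partial>M) \<le> ennreal ((1/2) ^ k)" .
  qed auto
  also have "\<dots> = ennreal 2"
    using suminf_geometric[of "1/2 :: real"] by (subst suminf_ennreal2) (auto intro: summable_geometric)
  also have "\<dots> < \<infinity>" by simp
  \<comment> \<open>A series with finite expectation is almost surely finite, and its value then
    bounds every single weighted increment.\<close>
  finally have "AE \<omega> in M. (\<Sum>k. ennreal (2 ^ k * \<Delta> k \<omega>)) \<noteq> \<infinity>"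
    by (intro nn_integral_PInf_AE) auto
  then have "AE \<omega> in M. \<forall>i\<in>I. convergent (\<lambda>n. g n i \<omega>)"
  proof eventually_elim
    case (elim \<omega>)
    define S where "S = (\<Sum>k. ennreal (2 ^ k * \<Delta> k \<omega>))"
    have le: "2 ^ k * \<Delta> k \<omega> \<le> enn2real S" for k
    proof -
      have "ennreal (2 ^ k * \<Delta> k \<omega>) = (\<Sum>j\<in>{k}. ennreal (2 ^ j * \<Delta> j \<omega>))" by simp
      also have "\<dots> \<le> S" unfolding S_def by (rule sum_le_suminf) auto
      finally show ?thesis using elim \<Delta>0 unfolding S_def[symmetric]
        by (metis enn2real_ennreal enn2real_mono infinity_ennreal_def less_top mult_nonneg_nonneg zero_le_numeral zero_le_power)
    qed
    show ?case
    proof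
      fix i assume i: "i \<in> I"
      show "convergent (\<lambda>n. g n i \<omega>)"
      proof (rule convergent_of_weighted_increments)
        fix k
        have "(norm (g (Suc k) i \<omega> - g k i \<omega>))\<^sup>2 \<le> \<Delta> k \<omega>"
          unfolding \<Delta>_def by (rule member_le_sum[OF i _ fin]) auto
        then have "2 ^ k * (norm (g (Suc k) i \<omega> - g k i \<omega>))\<^sup>2 \<le> 2 ^ k * \<Delta> k \<omega>" by simp
        then show "2 ^ k * (norm (g (Suc k) i \<omega> - g k i \<omega>))\<^sup>2 \<le> enn2real S" using le[of k] by linarith
      qed
    qed
  qed
  moreover have rn: "n \<le> r n" for n using r_mono by (rule seq_suble)
  moreover have "g n \<in> C n" for n using fC[of "r n"] anti[OF rn[of n]] by (auto simp: g_def)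
  moreover have "E M I (g n) \<le> E M I h + 1 / Suc n" if "\<And>k. h \<in> C k" for n h
  proof -
    have "1 / real (Suc (r n)) \<le> 1 / real (Suc n)" using rn[of n] by (simp add: field_simps)
    then show ?thesis using fE[of "r n"] d_le[OF that[of "r n"]] unfolding g_def by linarith
  qed
  ultimately show ?thesis using that[of g] by blast
qed

text \<open>Multiplying by \<open>1 / (1 + \<bar>K\<bar>)\<close> turns the bound \<open>K\<close>
  into the bound 1, which is square-integrable for a finite measure. The factor is positive and the
  same along the sequence, so dividing it out preserves pointwise convergence.\<close>

lemma convergent_selection_bounded:
  fixes C :: "nat \<Rightarrow> ('i \<Rightarrow> 'w \<Rightarrow> 'v::euclidean_space) set"
  assumes M: "finite_measure M" and fin: "finite I"
    and dec: "\<And>n. C (Suc n) \<subseteq> C n"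
    and mid: "\<And>n f g. f \<in> C n \<Longrightarrow> g \<in> C n \<Longrightarrow> (\<lambda>i \<omega>. (1/2) *\<^sub>R (f i \<omega> + g i \<omega>)) \<in> C n"
    and meas: "\<And>n f i. f \<in> C n \<Longrightarrow> i \<in> I \<Longrightarrow> f i \<in> borel_measurable M"
    and K[measurable]: "K \<in> borel_measurable M"
    and bnd: "\<And>n f i. f \<in> C n \<Longrightarrow> i \<in> I \<Longrightarrow> AE \<omega> in M. norm (f i \<omega>) \<le> K \<omega>"
    and ne: "\<And>n. C n \<noteq> {}"
  obtains f where "\<And>n. f n \<in> C n" "AE \<omega> in M. \<forall>i\<in>I. convergent (\<lambda>n. f n i \<omega>)"
proof -
  interpret finite_measure M by fact
  define \<rho> where "\<rho> \<omega> = 1 / (1 + \<bar>K \<omega>\<bar>)" for \<omega>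
  have \<rho>: "0 < \<rho> \<omega>" "\<rho> \<omega> * \<bar>K \<omega>\<bar> \<le> 1" for \<omega> by (auto simp: \<rho>_def divide_simps)
  have [measurable]: "\<rho> \<in> borel_measurable M" unfolding \<rho>_def by measurable
  define sc where "sc f = (\<lambda>i \<omega>. \<rho> \<omega> *\<^sub>R f i \<omega>)" for f :: "'i \<Rightarrow> 'w \<Rightarrow> 'v"
  have b1: "AE \<omega> in M. (norm (sc f i \<omega>))\<^sup>2 \<le> 1" if "f \<in> C n" "i \<in> I" for f i n
    using bnd[OF that]
  proof eventually_elim
    case (elim \<omega>)
    have "\<rho> \<omega> * norm (f i \<omega>) \<le> \<rho> \<omega> * \<bar>K \<omega>\<bar>" using elim \<rho>(1)[of \<omega>] by (intro mult_left_mono) auto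
    then have "norm (sc f i \<omega>) \<le> 1" using \<rho>[of \<omega>] unfolding sc_def norm_scaleR by linarith
    then show ?case by (simp add: power_le_one)
  qed
  have int: "integrable M (\<lambda>\<omega>. (norm (sc f i \<omega>))\<^sup>2)" if "f \<in> C n" "i \<in> I" for f i n
  proof (rule integrable_const_bound[where B=1])
    have [measurable]: "f i \<in> borel_measurable M" using meas[OF that] .
    show "(\<lambda>\<omega>. (norm (sc f i \<omega>))\<^sup>2) \<in> borel_measurable M" unfolding sc_def by measurable
    show "AE \<omega> in M. norm ((norm (sc f i \<omega>))\<^sup>2) \<le> 1" using b1[OF that] by simp
  qed
  obtain f where f: "\<And>n. f n \<in> (\<lambda>n. sc ` C n) n" "AE \<omega> in M. \<forall>i\<in>I. convergent (\<lambda>n. f n i \<omega>)"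
  proof (rule convergent_selection_L2[of I "\<lambda>n. sc ` C n" M "real (card I) * measure M (space M)"])
    show "finite I" by fact
    show "sc ` C (Suc n) \<subseteq> sc ` C n" for n using dec[of n] by auto
    show "(\<lambda>i \<omega>. (1/2) *\<^sub>R (f i \<omega> + g i \<omega>)) \<in> sc ` C n" if fg: "f \<in> sc ` C n" "g \<in> sc ` C n" for f g n
    proof -
      obtain f' g' where "f' \<in> C n" "g' \<in> C n" "f = sc f'" "g = sc g'" using fg by auto
      then show ?thesis using mid[of f' n g']
        by (intro image_eqI[of _ _ "\<lambda>i \<omega>. (1/2) *\<^sub>R (f' i \<omega> + g' i \<omega>)"]) (auto simp: sc_def algebra_simps fun_eq_iff)
    qed
    show "f i \<in> borel_measurable M" if f: "f \<in> sc ` C n" "i \<in> I" for f i n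
    proof -
      obtain f' where f': "f' \<in> C n" "f = sc f'" using f by auto
      have [measurable]: "f' i \<in> borel_measurable M" using meas[OF f'(1) f(2)] .
      show ?thesis unfolding f' sc_def by measurable
    qed
    show "integrable M (\<lambda>\<omega>. (norm (f i \<omega>))\<^sup>2)" if "f \<in> sc ` C n" "i \<in> I" for f i n
      using that int by auto
    show "\<exists>f\<in>sc ` C n. (\<integral>\<omega>. (\<Sum>i\<in>I. (norm (f i \<omega>))\<^sup>2) \<partial>M) \<le> real (card I) * measure M (space M)" for n
    proof -
      obtain f where f: "f \<in> C n" using ne by auto
      have "(\<integral>\<omega>. (\<Sum>i\<in>I. (norm (sc f i \<omega>))\<^sup>2) \<partial>M) = (\<Sum>i\<in>I. \<integral>\<omega>. (norm (sc f i \<omega>))\<^sup>2 \<partial>M)"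
        by (rule Bochner_Integration.integral_sum) (use int[OF f] in auto)
      also have "\<dots> \<le> (\<Sum>i\<in>I. measure M (space M))"
      proof (rule sum_mono)
        fix i assume i: "i \<in> I"
        have "(\<integral>\<omega>. (norm (sc f i \<omega>))\<^sup>2 \<partial>M) \<le> (\<integral>\<omega>. 1 \<partial>M)"
          by (rule integral_mono_AE[OF int[OF f i]]) (use b1[OF f i] in auto)
        then show "(\<integral>\<omega>. (norm (sc f i \<omega>))\<^sup>2 \<partial>M) \<le> measure M (space M)" by simp
      qed
      finally show ?thesis using f by auto
    qed
  next
    fix f assume "\<And>n. f n \<in> sc ` C n" "AE \<omega> in M. \<forall>i\<in>I. convergent (\<lambda>n. f n i \<omega>)"
    then show thesis by (rule that)
  qed
  have "\<exists>g. g \<in> C n \<and> f n = sc g" for n using f(1)[of n] by auto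
  then obtain g where g: "\<And>n. g n \<in> C n" "\<And>n. f n = sc (g n)" by metis
  have "AE \<omega> in M. \<forall>i\<in>I. convergent (\<lambda>n. g n i \<omega>)"
    using f(2)
  proof eventually_elim
    case (elim \<omega>)
    show ?case
    proof
      fix i assume "i \<in> I"
      then obtain l where "(\<lambda>n. \<rho> \<omega> *\<^sub>R g n i \<omega>) \<longlonglongrightarrow> l" using elim g(2) by (auto simp: sc_def convergent_def)
      then have "(\<lambda>n. (1 / \<rho> \<omega>) *\<^sub>R \<rho> \<omega> *\<^sub>R g n i \<omega>) \<longlonglongrightarrow> (1 / \<rho> \<omega>) *\<^sub>R l" by (intro tendsto_intros)
      then show "convergent (\<lambda>n. g n i \<omega>)" using \<rho>(1)[of \<omega>] by (auto simp: convergent_def)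
    qed
  qed
  with g(1) show ?thesis using that by blast
qed

section \<open>Reduced positions\<close>

definition null_positions :: "'w measure \<Rightarrow> 'w measure \<Rightarrow> ('w \<Rightarrow> 'v::euclidean_space) \<Rightarrow> ('w \<Rightarrow> 'v) set" where
  "null_positions M G X = {g \<in> borel_measurable G. AE \<omega> in M. g \<omega> \<bullet> X \<omega> = 0}"

text \<open>These play the role of positions with values in the linear span of the conditional
  support of \<open>X\<close>. Describing them by duality replaces a random subspace by almost sure
  identities, each with its own null set.\<close>

definition reduced_positions :: "'w measure \<Rightarrow> 'w measure \<Rightarrow> ('w \<Rightarrow> 'v::euclidean_space) \<Rightarrow> ('w \<Rightarrow> 'v) set" where
  "reduced_positions M G X = {h \<in> borel_measurable G. \<forall>g\<in>null_positions M G X. AE \<omega> in M. h \<omega> \<bullet> g \<omega> = 0}"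

lemma reduced_positions_midpoint:
  assumes "f \<in> reduced_positions M G X" "g \<in> reduced_positions M G X"
  shows "(\<lambda>\<omega>. (1/2) *\<^sub>R (f \<omega> + g \<omega>)) \<in> reduced_positions M G X"
proof -
  have "AE \<omega> in M. ((1/2) *\<^sub>R (f \<omega> + g \<omega>)) \<bullet> k \<omega> = 0" if "k \<in> null_positions M G X" for k
  proof -
    have "AE \<omega> in M. f \<omega> \<bullet> k \<omega> = 0" "AE \<omega> in M. g \<omega> \<bullet> k \<omega> = 0"
      using assms that by (auto simp: reduced_positions_def)
    then show ?thesis by eventually_elim (simp add: inner_add_left)
  qed
  then show ?thesis using assms by (auto simp: reduced_positions_def)
qed

lemma reduced_positions_lim:
  fixes f :: "nat \<Rightarrow> 'w \<Rightarrow> 'v::euclidean_space"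
  assumes f: "\<And>n. f n \<in> reduced_positions M G X" and conv: "AE \<omega> in M. convergent (\<lambda>n. f n \<omega>)"
  shows "(\<lambda>\<omega>. lim (\<lambda>n. f n \<omega>)) \<in> reduced_positions M G X"
proof -
  have [measurable]: "f n \<in> borel_measurable G" for n using f by (auto simp: reduced_positions_def)
  have "AE \<omega> in M. lim (\<lambda>n. f n \<omega>) \<bullet> k \<omega> = 0" if "k \<in> null_positions M G X" for k
  proof -
    have "AE \<omega> in M. \<forall>n. f n \<omega> \<bullet> k \<omega> = 0"
      using f that by (subst AE_all_countable) (auto simp: reduced_positions_def)
    then show ?thesis using conv
    proof eventually_elim
      case (elim \<omega>)
      have "(\<lambda>n. f n \<omega> \<bullet> k \<omega>) \<longlonglongrightarrow> lim (\<lambda>n. f n \<omega>) \<bullet> k \<omega>"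
        using elim(2) by (intro tendsto_intros) (simp add: convergent_LIMSEQ_iff)
      with elim(1) show ?case by (simp add: LIMSEQ_const_iff)
    qed
  qed
  then show ?thesis by (auto simp: reduced_positions_def intro!: borel_measurable_lim_metric)
qed

text \<open>This is an orthogonal projection of \<open>h\<close> onto the null positions in a
  weighted \<open>L\<^sup>2\<close> space. Null positions may be multiplied by
  \<open>G\<close>-measurable scalars, so minimality can be tested with a random coefficient; this
  yields orthogonality at almost every outcome and not merely in expectation.\<close>

lemma reduced_positions_decomposition:
  fixes X h :: "'w \<Rightarrow> 'v::euclidean_space"
  assumes "finite_measure M" and sub: "subalgebra M G" and h[measurable]: "h \<in> borel_measurable G"
  obtains g where "g \<in> null_positions M G X" "(\<lambda>\<omega>. h \<omega> - g \<omega>) \<in> reduced_positions M G X"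
proof -
  interpret finite_measure M by fact
  have GM: "f \<in> borel_measurable M" if "f \<in> borel_measurable G" for f :: "'w \<Rightarrow> 'v"
    using measurable_from_subalg[OF sub that] .
  note hM[measurable] = GM[OF h]
  define \<rho> where "\<rho> \<omega> = 1 / (1 + norm (h \<omega>))" for \<omega>
  have \<rho>: "0 < \<rho> \<omega>" "\<rho> \<omega> * norm (h \<omega>) \<le> 1" for \<omega>
    by (auto simp: \<rho>_def divide_simps add_pos_nonneg add_nonneg_eq_0_iff)
  have \<rho>m[measurable]: "\<rho> \<in> borel_measurable M" unfolding \<rho>_def by measurable
  define sc where "sc g = (\<lambda>(i::unit) \<omega>. \<rho> \<omega> *\<^sub>R (h \<omega> - g \<omega>))" for g
  \<comment> \<open>The weight makes \<open>h\<close> itself bounded by 1, so the zero null position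
    belongs to this set and it is nonempty. It serves unchanged at every index of the
    selection.\<close>
  define C where "C = {f. \<exists>g\<in>null_positions M G X. f = sc g \<and> integrable M (\<lambda>\<omega>. (norm (f () \<omega>))\<^sup>2)}"
  have nullM: "g \<in> borel_measurable M" if "g \<in> null_positions M G X" for g :: "'w \<Rightarrow> 'v"
    by (rule GM) (use that in \<open>simp add: null_positions_def\<close>)
  have scM: "sc g i \<in> borel_measurable M" if "g \<in> null_positions M G X" for g i
  proof -
    note nullM[OF that, measurable]
    show ?thesis unfolding sc_def by measurable
  qed
  have 0: "(\<lambda>_. 0) \<in> null_positions M G X" by (simp add: null_positions_def)
  have norm0: "(norm (sc (\<lambda>_. 0) () \<omega>))\<^sup>2 \<le> 1" for \<omega>
    using \<rho>[of \<omega>] by (simp add: sc_def power_le_one)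
  have int0: "integrable M (\<lambda>\<omega>. (norm (sc (\<lambda>_. 0) () \<omega>))\<^sup>2)"
    by (rule integrable_const_bound[where B=1]) (use norm0 scM[OF 0] in auto)
  obtain f where f: "\<And>n. f n \<in> C" "AE \<omega> in M. \<forall>i\<in>{()}. convergent (\<lambda>n. f n i \<omega>)"
    "\<And>n g. g \<in> C \<Longrightarrow> (\<integral>\<omega>. (norm (f n () \<omega>))\<^sup>2 \<partial>M) \<le> (\<integral>\<omega>. (norm (g () \<omega>))\<^sup>2 \<partial>M) + 1 / Suc n"
  proof (rule convergent_selection_L2[of "{()}" "\<lambda>_. C" M "measure M (space M)"])
    show "(\<lambda>i \<omega>. (1/2) *\<^sub>R (f i \<omega> + g i \<omega>)) \<in> C" if fg: "f \<in> C" "g \<in> C" for f g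
    proof -
      obtain f' g' where f': "f' \<in> null_positions M G X" "f = sc f'" "integrable M (\<lambda>\<omega>. (norm (f () \<omega>))\<^sup>2)"
        and g': "g' \<in> null_positions M G X" "g = sc g'" "integrable M (\<lambda>\<omega>. (norm (g () \<omega>))\<^sup>2)"
        using fg by (auto simp: C_def)
      have [measurable]: "f () \<in> borel_measurable M" "g () \<in> borel_measurable M"
        using scM f' g' by auto
      have "AE \<omega> in M. f' \<omega> \<bullet> X \<omega> = 0" "AE \<omega> in M. g' \<omega> \<bullet> X \<omega> = 0"
        using f' g' by (auto simp: null_positions_def)
      then have "AE \<omega> in M. ((1/2) *\<^sub>R (f' \<omega> + g' \<omega>)) \<bullet> X \<omega> = 0" by eventually_elim (simp add: inner_add_left)
      then have "(\<lambda>\<omega>. (1/2) *\<^sub>R (f' \<omega> + g' \<omega>)) \<in> null_positions M G X"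
        using f' g' by (auto simp: null_positions_def)
      moreover have "(\<lambda>i \<omega>. (1/2) *\<^sub>R (f i \<omega> + g i \<omega>)) = sc (\<lambda>\<omega>. (1/2) *\<^sub>R (f' \<omega> + g' \<omega>))"
      proof (intro ext)
        fix i \<omega>
        have "h \<omega> - (1/2) *\<^sub>R (f' \<omega> + g' \<omega>) = (1/2) *\<^sub>R ((h \<omega> - f' \<omega>) + (h \<omega> - g' \<omega>))"
          by (simp add: algebra_simps flip: scaleR_add_left)
        then show "(1/2) *\<^sub>R (f i \<omega> + g i \<omega>) = sc (\<lambda>\<omega>. (1/2) *\<^sub>R (f' \<omega> + g' \<omega>)) i \<omega>"
          unfolding f'(2) g'(2) sc_def by (simp add: scaleR_add_right)
      qed
      moreover have "integrable M (\<lambda>\<omega>. (norm ((1/2) *\<^sub>R (f () \<omega> + g () \<omega>)))\<^sup>2)"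
      proof (rule Bochner_Integration.integrable_bound)
        show "integrable M (\<lambda>\<omega>. (norm (f () \<omega>))\<^sup>2 + (norm (g () \<omega>))\<^sup>2)"
          using f' g' by auto
        have "(norm ((1/2) *\<^sub>R (a + b)))\<^sup>2 \<le> (norm a)\<^sup>2 + (norm b)\<^sup>2" for a b :: 'v
        proof -
          have "(norm ((1/2) *\<^sub>R (a + b)))\<^sup>2 \<le> ((norm a + norm b) / 2)\<^sup>2"
            by (rule power_mono) (use norm_triangle_ineq[of a b] in auto)
          also have "\<dots> = (norm a)\<^sup>2 + (norm b)\<^sup>2 - (((norm a)\<^sup>2 + (norm b)\<^sup>2) / 2 + ((norm a - norm b) / 2)\<^sup>2)"
            by (simp add: power2_eq_square field_simps)
          also have "\<dots> \<le> (norm a)\<^sup>2 + (norm b)\<^sup>2"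
            using zero_le_power2[of "norm a"] zero_le_power2[of "norm b"] zero_le_power2[of "(norm a - norm b) / 2"]
            by argo
          finally show ?thesis .
        qed
        then show "AE \<omega> in M. norm ((norm ((1/2) *\<^sub>R (f () \<omega> + g () \<omega>)))\<^sup>2) \<le> norm ((norm (f () \<omega>))\<^sup>2 + (norm (g () \<omega>))\<^sup>2)"
          by auto
      qed measurable
      ultimately show ?thesis unfolding C_def by blast
    qed
    show "f i \<in> borel_measurable M" if "f \<in> C" for f i using that scM by (auto simp: C_def)
    show "integrable M (\<lambda>\<omega>. (norm (f i \<omega>))\<^sup>2)" if "f \<in> C" "i \<in> {()}" for f i
      using that by (auto simp: C_def)
    show "\<exists>f\<in>C. (\<integral>\<omega>. (\<Sum>i\<in>{()}. (norm (f i \<omega>))\<^sup>2) \<partial>M) \<le> measure M (space M)"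
    proof (rule bexI)
      show "sc (\<lambda>_. 0) \<in> C" unfolding C_def using 0 int0 by blast
      have "(\<integral>\<omega>. (norm (sc (\<lambda>_. 0) () \<omega>))\<^sup>2 \<partial>M) \<le> (\<integral>\<omega>. 1 \<partial>M)"
        by (rule integral_mono[OF int0]) (use norm0 in auto)
      then show "(\<integral>\<omega>. (\<Sum>i\<in>{()}. (norm (sc (\<lambda>_. 0) i \<omega>))\<^sup>2) \<partial>M) \<le> measure M (space M)" by simp
    qed
  next
    fix f
    assume a: "\<And>n::nat. f n \<in> C" "AE \<omega> in M. \<forall>i\<in>{()}. convergent (\<lambda>n. f n i \<omega>)"
      and b: "\<And>n g. (\<And>k::nat. g \<in> C) \<Longrightarrow> (\<integral>\<omega>. (\<Sum>i\<in>{()}. (norm (f n i \<omega>))\<^sup>2) \<partial>M)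
        \<le> (\<integral>\<omega>. (\<Sum>i\<in>{()}. (norm (g i \<omega>))\<^sup>2) \<partial>M) + 1 / Suc n"
    show thesis
      by (rule that[OF a]) (use b in simp_all)
  qed auto
  have "\<exists>g. g \<in> null_positions M G X \<and> f n = sc g \<and> integrable M (\<lambda>\<omega>. (norm (sc g () \<omega>))\<^sup>2)" for n
    using f(1)[of n] by (auto simp: C_def)
  then obtain g where g: "\<And>n. g n \<in> null_positions M G X" "\<And>n. f n = sc (g n)"
    "\<And>n. integrable M (\<lambda>\<omega>. (norm (sc (g n) () \<omega>))\<^sup>2)" by metis
  have gG[measurable]: "g n \<in> borel_measurable G" for n using g(1) by (auto simp: null_positions_def)
  have gM[measurable]: "g n \<in> borel_measurable M" for n using GM[OF gG] .
  have conv: "AE \<omega> in M. (\<lambda>n. g n \<omega>) \<longlonglongrightarrow> lim (\<lambda>n. g n \<omega>)"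
    using f(2)
  proof eventually_elim
    case (elim \<omega>)
    then obtain l where "(\<lambda>n. \<rho> \<omega> *\<^sub>R (h \<omega> - g n \<omega>)) \<longlonglongrightarrow> l" using g(2) by (auto simp: sc_def convergent_def)
    then have "(\<lambda>n. h \<omega> - (1 / \<rho> \<omega>) *\<^sub>R \<rho> \<omega> *\<^sub>R (h \<omega> - g n \<omega>)) \<longlonglongrightarrow> h \<omega> - (1 / \<rho> \<omega>) *\<^sub>R l" by (intro tendsto_intros)
    then show ?case using \<rho>(1)[of \<omega>] by (auto simp flip: convergent_LIMSEQ_iff simp: convergent_def)
  qed
  define L where "L \<omega> = lim (\<lambda>n. g n \<omega>)" for \<omega>
  have LG[measurable]: "L \<in> borel_measurable G" unfolding L_def by (rule borel_measurable_lim_metric) simp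
  have LM[measurable]: "L \<in> borel_measurable M" using GM[OF LG] .
  have "AE \<omega> in M. \<forall>n. g n \<omega> \<bullet> X \<omega> = 0"
    using g(1) by (subst AE_all_countable) (auto simp: null_positions_def)
  then have "AE \<omega> in M. L \<omega> \<bullet> X \<omega> = 0"
    using conv
  proof eventually_elim
    case (elim \<omega>)
    have "(\<lambda>n. g n \<omega> \<bullet> X \<omega>) \<longlonglongrightarrow> L \<omega> \<bullet> X \<omega>" unfolding L_def by (intro tendsto_intros elim)
    with elim(1) show ?case by (simp add: LIMSEQ_const_iff)
  qed
  then have L_null: "L \<in> null_positions M G X" by (simp add: null_positions_def)
  have "AE \<omega> in M. (h \<omega> - L \<omega>) \<bullet> k \<omega> = 0" if k: "k \<in> null_positions M G X" for k
  proof -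
    have kG[measurable]: "k \<in> borel_measurable G" using k by (auto simp: null_positions_def)
    have kM[measurable]: "k \<in> borel_measurable M" using GM[OF kG] .
    \<comment> \<open>The amount by which the weighted squared norm drops when the component of
      \<open>h - g\<close> along \<open>k\<close> is removed. Where \<open>k\<close> vanishes the
      quotient is 0 by the convention for division, and orthogonality is trivial there.\<close>
    define q where "q g \<omega> = (\<rho> \<omega>)\<^sup>2 * (((h \<omega> - g \<omega>) \<bullet> k \<omega>)\<^sup>2 / (norm (k \<omega>))\<^sup>2)" for g \<omega>
    have qM[measurable]: "q g \<in> borel_measurable M" if "g \<in> borel_measurable M" for g
      unfolding q_def using that by measurable
    have q0: "0 \<le> q g \<omega>" for g \<omega> by (simp add: q_def)
    have q_int: "(\<integral>\<^sup>+\<omega>. ennreal (q (g n) \<omega>) \<partial>M) \<le> ennreal (1 / Suc n)" for n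
    proof -
      \<comment> \<open>Subtracting the component of \<open>h - g n\<close> along \<open>k\<close> cannot beat the almost-minimiser.\<close>
      define g' where "g' \<omega> = g n \<omega> + (((h \<omega> - g n \<omega>) \<bullet> k \<omega>) / (norm (k \<omega>))\<^sup>2) *\<^sub>R k \<omega>" for \<omega>
      have "AE \<omega> in M. g n \<omega> \<bullet> X \<omega> = 0" "AE \<omega> in M. k \<omega> \<bullet> X \<omega> = 0"
        using k g(1) by (auto simp: null_positions_def)
      then have "AE \<omega> in M. g' \<omega> \<bullet> X \<omega> = 0" by eventually_elim (simp add: g'_def inner_add_left)
      moreover have "g' \<in> borel_measurable G" unfolding g'_def by measurable
      ultimately have g': "g' \<in> null_positions M G X" by (simp add: null_positions_def)
      have eq: "(norm (sc g' () \<omega>))\<^sup>2 = (norm (sc (g n) () \<omega>))\<^sup>2 - q (g n) \<omega>" for \<omega>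
      proof -
        have "(norm (a - ((a \<bullet> b) / (norm b)\<^sup>2) *\<^sub>R b))\<^sup>2 = (norm a)\<^sup>2 - (a \<bullet> b)\<^sup>2 / (norm b)\<^sup>2" for a b :: 'v
        proof (cases "b = 0")
          case False
          have "(norm (a - ((a \<bullet> b) / (norm b)\<^sup>2) *\<^sub>R b))\<^sup>2
              = a \<bullet> a - 2 * ((a \<bullet> b) / (b \<bullet> b)) * (a \<bullet> b) + ((a \<bullet> b) / (b \<bullet> b)) * ((a \<bullet> b) / (b \<bullet> b)) * (b \<bullet> b)"
            by (simp only: power2_norm_eq_inner) (simp add: algebra_simps inner_commute)
          also have "\<dots> = a \<bullet> a - (a \<bullet> b)\<^sup>2 / (b \<bullet> b)"
            using False by (simp add: field_simps power2_eq_square)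
          finally show ?thesis by (simp only: power2_norm_eq_inner)
        qed simp
        from this[of "h \<omega> - g n \<omega>" "k \<omega>"] show ?thesis
          unfolding sc_def g'_def q_def
          by (simp add: power_mult_distrib diff_diff_eq[symmetric] right_diff_distrib)
      qed
      have q_le: "q (g n) \<omega> \<le> (norm (sc (g n) () \<omega>))\<^sup>2" for \<omega>
        using eq[of \<omega>] zero_le_power2[of "norm (sc g' () \<omega>)"] by linarith
      have qi: "integrable M (q (g n))"
        by (rule Bochner_Integration.integrable_bound[OF g(3)[of n]]) (use q_le q0 in auto)
      have gi: "integrable M (\<lambda>\<omega>. (norm (sc g' () \<omega>))\<^sup>2)"
        unfolding eq using qi g(3)[of n] by auto
      then have "sc g' \<in> C" unfolding C_def using g' by blast
      then have "(\<integral>\<omega>. (norm (sc (g n) () \<omega>))\<^sup>2 \<partial>M) \<le> (\<integral>\<omega>. (norm (sc g' () \<omega>))\<^sup>2 \<partial>M) + 1 / Suc n"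
        using f(3)[of "sc g'" n] unfolding g(2) by simp
      moreover have "(\<integral>\<omega>. (norm (sc g' () \<omega>))\<^sup>2 \<partial>M) = (\<integral>\<omega>. (norm (sc (g n) () \<omega>))\<^sup>2 \<partial>M) - (\<integral>\<omega>. q (g n) \<omega> \<partial>M)"
        unfolding eq using qi g(3)[of n] by simp
      ultimately have "(\<integral>\<omega>. q (g n) \<omega> \<partial>M) \<le> 1 / Suc n" by linarith
      then show ?thesis using qi q0 by (subst nn_integral_eq_integral) (auto intro: ennreal_leI)
    qed
    \<comment> \<open>At a fixed outcome \<open>q\<close> depends continuously on the value of
      \<open>g\<close>, so Fatou carries the bounds \<open>1 / Suc n\<close> over to the limit and
      forces \<open>q L\<close> to vanish almost surely.\<close>
    have "AE \<omega> in M. ennreal (q L \<omega>) = liminf (\<lambda>n. ennreal (q (g n) \<omega>))"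
      using conv
    proof eventually_elim
      case (elim \<omega>)
      have "(\<lambda>n. q (g n) \<omega>) \<longlonglongrightarrow> q L \<omega>"
      proof (cases "k \<omega> = 0")
        case False
        then show ?thesis unfolding q_def L_def by (intro tendsto_intros elim) auto
      qed (simp add: q_def)
      then have "(\<lambda>n. ennreal (q (g n) \<omega>)) \<longlonglongrightarrow> ennreal (q L \<omega>)" by (rule tendsto_ennrealI)
      then show ?case by (metis lim_imp_Liminf sequentially_bot)
    qed
    then have "(\<integral>\<^sup>+\<omega>. ennreal (q L \<omega>) \<partial>M) = (\<integral>\<^sup>+\<omega>. liminf (\<lambda>n. ennreal (q (g n) \<omega>)) \<partial>M)"
      by (rule nn_integral_cong_AE)
    also have "\<dots> \<le> liminf (\<lambda>n. \<integral>\<^sup>+\<omega>. ennreal (q (g n) \<omega>) \<partial>M)"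
      by (rule nn_integral_liminf) measurable
    also have "\<dots> \<le> liminf (\<lambda>n. ennreal (1 / Suc n))"
      by (intro Liminf_mono always_eventually allI q_int)
    also have "\<dots> = ennreal 0"
      by (intro lim_imp_Liminf tendsto_ennrealI LIMSEQ_Suc[OF lim_1_over_n]) auto
    finally have "AE \<omega> in M. ennreal (q L \<omega>) = 0"
      by (subst nn_integral_0_iff_AE[symmetric]) auto
    then show ?thesis
    proof eventually_elim
      case (elim \<omega>)
      then have "q L \<omega> = 0" using q0[of L \<omega>] by (simp add: ennreal_eq_0_iff)
      then show ?case using \<rho>(1)[of \<omega>] by (auto simp: q_def)
    qed
  qed
  then have "(\<lambda>\<omega>. h \<omega> - L \<omega>) \<in> reduced_positions M G X"
    by (auto simp: reduced_positions_def)
  with L_null show ?thesis using that by blast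
qed

text \<open>The Euclidean norm is at most the sum of the absolute coordinates, hence at most the
  dimension times the largest one. Having norm 1 may be lost under midpoints, whereas a lower bound
  for the component along a fixed direction is kept by midpoints and limits; finitely many
  directions suffice.\<close>

lemma exists_dominant_direction:
  fixes x :: "'v::euclidean_space"
  shows "\<exists>e\<in>Basis \<union> uminus ` Basis. norm x \<le> real DIM('v) * (x \<bullet> e)"
proof (rule ccontr)
  assume n: "\<not> ?thesis"
  have "real DIM('v) * \<bar>x \<bullet> b\<bar> < norm x" if "b \<in> Basis" for b
  proof -
    have "\<not> norm x \<le> real DIM('v) * (x \<bullet> b)" "\<not> norm x \<le> real DIM('v) * (x \<bullet> (- b))"
      using n that by blast+
    then show ?thesis by (cases "0 \<le> x \<bullet> b") auto
  qed
  then have "(\<Sum>b\<in>Basis. real DIM('v) * \<bar>x \<bullet> b\<bar>) < (\<Sum>b\<in>(Basis::'v set). norm x)"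
    by (intro sum_strict_mono) auto
  then have "(\<Sum>b\<in>Basis. \<bar>x \<bullet> b\<bar>) < norm x"
    by (simp add: sum_distrib_left[symmetric])
  with norm_le_l1[of x] show False by simp
qed

text \<open>If the positions were unbounded on a non-null set, normalising them along a dominant direction
  would produce in the limit a non-zero reduced position whose gain is nonnegative, hence null.\<close>

lemma reduced_positions_bounded:
  fixes X :: "'w \<Rightarrow> 'v::euclidean_space" and h :: "nat \<Rightarrow> 'w \<Rightarrow> 'v"
  assumes "prob_space M" and sub: "subalgebra M G"
    and na: "\<And>g. g \<in> borel_measurable G \<Longrightarrow> AE \<omega> in M. 0 \<le> g \<omega> \<bullet> X \<omega> \<Longrightarrow> AE \<omega> in M. g \<omega> \<bullet> X \<omega> = 0"
    and h: "\<And>n. h n \<in> reduced_positions M G X"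
    and w: "\<And>n. AE \<omega> in M. - w \<omega> \<le> h n \<omega> \<bullet> X \<omega>"
  shows "AE \<omega> in M. \<exists>K. \<forall>n. norm (h n \<omega>) \<le> K"
proof -
  interpret prob_space M by fact
  define d where "d = real DIM('v)"
  have d: "d > 0" by (simp add: d_def)
  have spG: "space G = space M" using sub by (simp add: subalgebra_def)
  have hG[measurable]: "h n \<in> borel_measurable G" for n using h by (auto simp: reduced_positions_def)
  define P where "P e n j \<omega> \<longleftrightarrow> real (Suc n) \<le> norm (h j \<omega>) \<and> norm (h j \<omega>) \<le> d * (h j \<omega> \<bullet> e)" for e n j \<omega>
  have Pm[measurable]: "Measurable.pred G (P e n j)" for e n j unfolding P_def by measurable
  define A where "A e = {\<omega>\<in>space G. \<forall>n. \<exists>j. P e n j \<omega>}" for e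
  have AG: "A e \<in> sets G" for e unfolding A_def by measurable
  have null: "AE \<omega> in M. \<omega> \<notin> A e" for e
  proof -
    note AG[of e, measurable]
    \<comment> \<open>No single index is large on all of \<open>A e\<close>, so a first suitable
      index is chosen outcome by outcome; taking the least one keeps it
      \<open>G\<close>-measurable.\<close>
    define \<tau> where "\<tau> n \<omega> = (LEAST j. P e n j \<omega>)" for n \<omega>
    have \<tau>m[measurable]: "\<tau> n \<in> measurable G (count_space UNIV)" for n unfolding \<tau>_def by measurable
    have \<tau>P: "P e n (\<tau> n \<omega>) \<omega>" if "\<omega> \<in> A e" for n \<omega>
      using that LeastI_ex[of "\<lambda>j. P e n j \<omega>"] by (auto simp: A_def \<tau>_def)
    define g where "g n \<omega> = (indicator (A e) \<omega> / norm (h (\<tau> n \<omega>) \<omega>)) *\<^sub>R h (\<tau> n \<omega>) \<omega>" for n \<omega>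
    have "(\<lambda>\<omega>. (\<lambda>j \<omega>. (indicator (A e) \<omega> / norm (h j \<omega>)) *\<^sub>R h j \<omega>) (\<tau> n \<omega>) \<omega>) \<in> borel_measurable G" for n
      by (rule measurable_compose_countable) measurable
    then have gG: "g n \<in> borel_measurable G" for n by (simp add: g_def[abs_def])
    \<comment> \<open>Before normalisation the gain is at least \<open>-w\<close> and the norm is at
      least \<open>Suc n\<close>, so afterwards the loss is at most
      \<open>\<bar>w\<bar> / Suc n\<close>. The bound along \<open>e\<close> keeps the limit away
      from zero on \<open>A e\<close>.\<close>
    define C where "C n = {f :: unit \<Rightarrow> 'w \<Rightarrow> 'v. f () \<in> reduced_positions M G X \<and>
        (AE \<omega> in M. norm (f () \<omega>) \<le> 1) \<and> (AE \<omega> in M. \<omega> \<in> A e \<longrightarrow> 1 \<le> d * (f () \<omega> \<bullet> e)) \<and>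
        (AE \<omega> in M. - (\<bar>w \<omega>\<bar> / Suc n) \<le> f () \<omega> \<bullet> X \<omega>)}" for n
    obtain f where f: "\<And>n. f n \<in> C n" "AE \<omega> in M. \<forall>i\<in>{()}. convergent (\<lambda>n. f n i \<omega>)"
    proof (rule convergent_selection_bounded[of M "{()}" C "\<lambda>_. 1"])
      show "finite_measure M" by unfold_locales
      show "C (Suc n) \<subseteq> C n" for n
      proof
        fix f assume f: "f \<in> C (Suc n)"
        then have "AE \<omega> in M. - (\<bar>w \<omega>\<bar> / Suc (Suc n)) \<le> f () \<omega> \<bullet> X \<omega>" by (simp add: C_def)
        then have "AE \<omega> in M. - (\<bar>w \<omega>\<bar> / Suc n) \<le> f () \<omega> \<bullet> X \<omega>"
        proof eventually_elim
          case (elim \<omega>)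
          have "\<bar>w \<omega>\<bar> / Suc (Suc n) \<le> \<bar>w \<omega>\<bar> / Suc n" by (rule divide_left_mono) auto
          with elim show ?case by linarith
        qed
        with f show "f \<in> C n" by (simp add: C_def)
      qed
      show "(\<lambda>i \<omega>. (1/2) *\<^sub>R (f i \<omega> + g i \<omega>)) \<in> C n" if f: "f \<in> C n" and g: "g \<in> C n" for n f g
      proof -
        have "AE \<omega> in M. norm (f () \<omega>) \<le> 1" "AE \<omega> in M. norm (g () \<omega>) \<le> 1"
          using f g by (auto simp: C_def)
        then have "AE \<omega> in M. norm ((1/2) *\<^sub>R (f () \<omega> + g () \<omega>)) \<le> 1"
        proof eventually_elim
          case (elim \<omega>)
          then show ?case using norm_triangle_ineq[of "f () \<omega>" "g () \<omega>"] by simp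
        qed
        moreover have "AE \<omega> in M. \<omega> \<in> A e \<longrightarrow> 1 \<le> d * (f () \<omega> \<bullet> e)" "AE \<omega> in M. \<omega> \<in> A e \<longrightarrow> 1 \<le> d * (g () \<omega> \<bullet> e)"
          using f g by (auto simp: C_def)
        then have "AE \<omega> in M. \<omega> \<in> A e \<longrightarrow> 1 \<le> d * (((1/2) *\<^sub>R (f () \<omega> + g () \<omega>)) \<bullet> e)"
          by eventually_elim (auto simp: inner_add_left distrib_left)
        moreover have "AE \<omega> in M. - (\<bar>w \<omega>\<bar> / Suc n) \<le> f () \<omega> \<bullet> X \<omega>" "AE \<omega> in M. - (\<bar>w \<omega>\<bar> / Suc n) \<le> g () \<omega> \<bullet> X \<omega>"
          using f g by (auto simp: C_def)
        then have "AE \<omega> in M. - (\<bar>w \<omega>\<bar> / Suc n) \<le> ((1/2) *\<^sub>R (f () \<omega> + g () \<omega>)) \<bullet> X \<omega>"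
        proof eventually_elim
          case (elim \<omega>)
          then show ?case unfolding inner_scaleR_left inner_add_left by argo
        qed
        ultimately show ?thesis
          using f g reduced_positions_midpoint[of "f ()" M G X "g ()"] by (simp add: C_def)
      qed
      show "f i \<in> borel_measurable M" if "f \<in> C n" "i \<in> {()}" for n f i
        using that by (auto simp: C_def reduced_positions_def intro: measurable_from_subalg[OF sub])
      show "AE \<omega> in M. norm (f i \<omega>) \<le> 1" if "f \<in> C n" "i \<in> {()}" for n f i
        using that by (auto simp: C_def)
      show "C n \<noteq> {}" for n
      proof -
        have "AE \<omega> in M. g n \<omega> \<bullet> k \<omega> = 0" if k: "k \<in> null_positions M G X" for k
        proof -
          \<comment> \<open>The position used depends on the outcome through \<open>\<tau>\<close>,
            so orthogonality must hold for all indices off one common null set.\<close>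
          have "AE \<omega> in M. \<forall>j. h j \<omega> \<bullet> k \<omega> = 0"
            using h k by (subst AE_all_countable) (auto simp: reduced_positions_def)
          then show ?thesis by eventually_elim (simp add: g_def)
        qed
        then have "g n \<in> reduced_positions M G X" using gG by (auto simp: reduced_positions_def)
        moreover have "norm (g n \<omega>) \<le> 1" for \<omega> by (auto simp: g_def indicator_def)
        moreover have "1 \<le> d * (g n \<omega> \<bullet> e)" if "\<omega> \<in> A e" for \<omega>
        proof -
          have "real (Suc n) \<le> norm (h (\<tau> n \<omega>) \<omega>)" "norm (h (\<tau> n \<omega>) \<omega>) \<le> d * (h (\<tau> n \<omega>) \<omega> \<bullet> e)"
            using \<tau>P[OF that, of n] unfolding P_def by auto
          moreover have "h (\<tau> n \<omega>) \<omega> \<noteq> 0" using calculation(1) by auto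
          ultimately show ?thesis using that by (simp add: g_def divide_simps)
        qed
        moreover have "AE \<omega> in M. - (\<bar>w \<omega>\<bar> / Suc n) \<le> g n \<omega> \<bullet> X \<omega>"
        proof -
          have "AE \<omega> in M. \<forall>j. - w \<omega> \<le> h j \<omega> \<bullet> X \<omega>" using w by (simp add: AE_all_countable)
          then show ?thesis
          proof eventually_elim
            case (elim \<omega>)
            show ?case
            proof (cases "\<omega> \<in> A e")
              case True
              define N where "N = norm (h (\<tau> n \<omega>) \<omega>)"
              have N: "real (Suc n) \<le> N" using \<tau>P[OF True, of n] unfolding P_def N_def by auto
              then have N0: "0 < N" by (rule less_le_trans[rotated]) simp
              have "\<bar>w \<omega>\<bar> / N \<le> \<bar>w \<omega>\<bar> / Suc n" using N N0 by (intro divide_left_mono) auto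
              moreover have "- (\<bar>w \<omega>\<bar> / N) \<le> (h (\<tau> n \<omega>) \<omega> \<bullet> X \<omega>) / N"
              proof -
                have "- \<bar>w \<omega>\<bar> \<le> h (\<tau> n \<omega>) \<omega> \<bullet> X \<omega>" using elim[rule_format, of "\<tau> n \<omega>"] by linarith
                then have "- \<bar>w \<omega>\<bar> / N \<le> (h (\<tau> n \<omega>) \<omega> \<bullet> X \<omega>) / N" using N0 by (intro divide_right_mono) auto
                then show ?thesis by simp
              qed
              ultimately show ?thesis using True by (simp add: g_def N_def)
            qed (simp add: g_def)
          qed
        qed
        ultimately have "(\<lambda>_. g n) \<in> C n" by (simp add: C_def)
        then show ?thesis by auto
      qed
    next
      fix f assume "\<And>n. f n \<in> C n" "AE \<omega> in M. \<forall>i\<in>{()}. convergent (\<lambda>n. f n i \<omega>)"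
      then show thesis by (rule that)
    qed simp_all
    define L where "L \<omega> = lim (\<lambda>n. f n () \<omega>)" for \<omega>
    have conv: "AE \<omega> in M. convergent (\<lambda>n. f n () \<omega>)" using f(2) by simp
    have fr: "f n () \<in> reduced_positions M G X" for n using f(1)[of n] by (simp add: C_def)
    have Lr: "L \<in> reduced_positions M G X" unfolding L_def by (rule reduced_positions_lim[OF fr conv])
    have a1: "AE \<omega> in M. \<forall>n. \<omega> \<in> A e \<longrightarrow> 1 \<le> d * (f n () \<omega> \<bullet> e)"
      using f(1) by (subst AE_all_countable) (auto simp: C_def)
    have a2: "AE \<omega> in M. \<forall>n. - (\<bar>w \<omega>\<bar> / Suc n) \<le> f n () \<omega> \<bullet> X \<omega>"
      using f(1) by (subst AE_all_countable) (auto simp: C_def)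
    from a2 conv have "AE \<omega> in M. 0 \<le> L \<omega> \<bullet> X \<omega>"
    proof eventually_elim
      case (elim \<omega>)
      have "(\<lambda>n. f n () \<omega> \<bullet> X \<omega>) \<longlonglongrightarrow> L \<omega> \<bullet> X \<omega>"
        unfolding L_def using elim(2) by (intro tendsto_intros) (simp add: convergent_LIMSEQ_iff)
      moreover have "(\<lambda>n. - (\<bar>w \<omega>\<bar> * (1 / Suc n))) \<longlonglongrightarrow> - (\<bar>w \<omega>\<bar> * 0)"
        by (intro tendsto_intros LIMSEQ_Suc[OF lim_1_over_n])
      ultimately show ?case using elim(1) by (intro LIMSEQ_le[of _ "- (\<bar>w \<omega>\<bar> * 0)" _ "L \<omega> \<bullet> X \<omega>", simplified]) auto
    qed
    then have "AE \<omega> in M. L \<omega> \<bullet> X \<omega> = 0" using Lr by (intro na) (auto simp: reduced_positions_def)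
    \<comment> \<open>Being both null and reduced, \<open>L\<close> is orthogonal to itself and
      vanishes almost surely, against \<open>1 \<le> d * (L \<omega> \<bullet> e)\<close> on
      \<open>A e\<close>.\<close>
    then have "L \<in> null_positions M G X" using Lr by (auto simp: reduced_positions_def null_positions_def)
    then have "AE \<omega> in M. L \<omega> \<bullet> L \<omega> = 0" using Lr by (auto simp: reduced_positions_def)
    then show ?thesis using a1 conv
    proof eventually_elim
      case (elim \<omega>)
      show ?case
      proof
        assume "\<omega> \<in> A e"
        then have "1 \<le> d * (f n () \<omega> \<bullet> e)" for n using elim(2) by blast
        moreover have "(\<lambda>n. d * (f n () \<omega> \<bullet> e)) \<longlonglongrightarrow> d * (L \<omega> \<bullet> e)"
          unfolding L_def using elim(3) by (intro tendsto_intros) (simp add: convergent_LIMSEQ_iff)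
        ultimately have "1 \<le> d * (L \<omega> \<bullet> e)" by (intro LIMSEQ_le_const) auto
        with elim(1) show False by simp
      qed
    qed
  qed
  have "AE \<omega> in M. \<forall>e\<in>Basis \<union> uminus ` Basis. \<omega> \<notin> A e"
    by (rule AE_finite_allI) (use null in auto)
  then show ?thesis using AE_space
  proof eventually_elim
    case (elim \<omega>)
    then have "\<forall>e\<in>Basis \<union> uminus ` Basis. \<exists>n. \<forall>j. \<not> P e n j \<omega>" by (auto simp: A_def spG)
    then obtain N where N: "\<And>e j. e \<in> Basis \<union> uminus ` Basis \<Longrightarrow> \<not> P e (N e) j \<omega>" by metis
    define m where "m = Max (N ` (Basis \<union> uminus ` Basis))"
    have m: "N e \<le> m" if "e \<in> Basis \<union> uminus ` Basis" for e
      unfolding m_def by (rule Max_ge) (use that in auto)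
    have "norm (h j \<omega>) \<le> real (Suc m)" for j
    proof (rule ccontr)
      assume a: "\<not> ?thesis"
      obtain e where e: "e \<in> Basis \<union> uminus ` Basis" "norm (h j \<omega>) \<le> d * (h j \<omega> \<bullet> e)"
        using exists_dominant_direction[of "h j \<omega>"] by (auto simp: d_def)
      have "real (Suc (N e)) \<le> real (Suc m)" using m[OF e(1)] by simp
      then have "P e (N e) j \<omega>" using a e(2) unfolding P_def by linarith
      with N[OF e(1)] show False by blast
    qed
    then show ?case by blast
  qed
qed

section \<open>Optimal strategies in a dominated market\<close>

lemma wealth_Suc:
  "wealth S w \<phi> (Suc t) \<omega> = wealth S w \<phi> t \<omega> + \<phi> (Suc t) \<omega> \<bullet> (S (Suc t) \<omega> - S t \<omega>)"
  by (simp add: wealth_def)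

lemma wealth_midpoint:
  "wealth S w (\<lambda>t \<omega>. (1/2) *\<^sub>R (\<phi> t \<omega> + \<psi> t \<omega>)) t \<omega> = (wealth S w \<phi> t \<omega> + wealth S w \<psi> t \<omega>) / 2"
  by (simp add: wealth_def inner_add_left sum.distrib sum_divide_distrib[symmetric] field_simps)

lemma wealth_cong_AE:
  assumes "\<And>s. s \<in> {1..t} \<Longrightarrow> AE \<omega> in M. \<psi> s \<omega> \<bullet> (S s \<omega> - S (s - 1) \<omega>) = \<phi> s \<omega> \<bullet> (S s \<omega> - S (s - 1) \<omega>)"
  shows "AE \<omega> in M. wealth S w \<psi> t \<omega> = wealth S w \<phi> t \<omega>"
proof -
  have "AE \<omega> in M. \<forall>s\<in>{1..t}. \<psi> s \<omega> \<bullet> (S s \<omega> - S (s - 1) \<omega>) = \<phi> s \<omega> \<bullet> (S s \<omega> - S (s - 1) \<omega>)"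
    by (rule AE_finite_allI) (use assms in auto)
  then show ?thesis by eventually_elim (simp add: wealth_def)
qed

lemma NA_one_step:
  fixes S :: "nat \<Rightarrow> 'w \<Rightarrow> 'v::euclidean_space"
  assumes NA: "NA M F T S" and t: "t \<in> {1..T}" and g: "g \<in> borel_measurable (F (t - 1))"
    and pos: "AE \<omega> in M. 0 \<le> g \<omega> \<bullet> (S t \<omega> - S (t - 1) \<omega>)"
  shows "AE \<omega> in M. g \<omega> \<bullet> (S t \<omega> - S (t - 1) \<omega>) = 0"
proof -
  define \<phi> where "\<phi> s = (if s = t then g else (\<lambda>_. 0))" for s
  have "\<phi> \<in> strategies F T" using g by (auto simp: strategies_def \<phi>_def)
  with NA have *: "(AE \<omega> in M. 0 \<le> wealth S 0 \<phi> T \<omega>) \<longrightarrow> (AE \<omega> in M. wealth S 0 \<phi> T \<omega> = 0)"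
    unfolding NA_def by (rule bspec)
  have "wealth S 0 \<phi> T \<omega> = g \<omega> \<bullet> (S t \<omega> - S (t - 1) \<omega>)" for \<omega>
  proof -
    have "wealth S 0 \<phi> T \<omega> = (\<Sum>s\<in>{1..T}. if s = t then g \<omega> \<bullet> (S t \<omega> - S (t - 1) \<omega>) else 0)"
      unfolding wealth_def add_0 by (intro sum.cong) (auto simp: \<phi>_def)
    then show ?thesis using t by simp
  qed
  then show ?thesis using * pos by (simp only: simp_thms)
qed

text \<open>Domination survives only as \<open>transfer\<close>; from here on neither conditional
  distributions nor affine hulls appear.\<close>

locale dominated_market = prob_space M for M :: "'w measure" +
  fixes F :: "nat \<Rightarrow> 'w measure" and T :: nat and SS :: "(nat \<Rightarrow> 'w \<Rightarrow> 'v::euclidean_space) set"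
    and R :: "nat \<Rightarrow> 'w \<Rightarrow> 'v"
  assumes sub: "t \<le> T \<Longrightarrow> subalgebra M (F t)"
    and adapted: "S \<in> SS \<Longrightarrow> t \<le> T \<Longrightarrow> S t \<in> borel_measurable (F t)"
    and R: "R \<in> SS" "NA M F T R"
    and transfer: "S \<in> SS \<Longrightarrow> t \<in> {1..T} \<Longrightarrow> h \<in> borel_measurable (F (t - 1)) \<Longrightarrow>
      AE \<omega> in M. h \<omega> \<bullet> (R t \<omega> - R (t - 1) \<omega>) = 0 \<Longrightarrow> AE \<omega> in M. h \<omega> \<bullet> (S t \<omega> - S (t - 1) \<omega>) = 0"
begin

abbreviation reduced :: "nat \<Rightarrow> ('w \<Rightarrow> 'v) set" where
  "reduced t \<equiv> reduced_positions M (F (t - 1)) (\<lambda>\<omega>. R t \<omega> - R (t - 1) \<omega>)"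

lemma sub_pred: "t \<in> {1..T} \<Longrightarrow> subalgebra M (F (t - 1))"
  by (rule sub) auto

lemma strategy_measurable:
  assumes "\<phi> \<in> strategies F T" "t \<in> {1..T}"
  shows "\<phi> t \<in> borel_measurable M"
  using assms by (intro measurable_from_subalg[OF sub_pred]) (auto simp: strategies_def)

lemma wealth_measurable:
  assumes "S \<in> SS" "\<phi> \<in> strategies F T" "t \<le> T"
  shows "wealth S w \<phi> t \<in> borel_measurable M"
proof -
  have S: "S s \<in> borel_measurable M" if "s \<le> T" for s
    using measurable_from_subalg[OF sub[OF that] adapted[OF assms(1) that]] .
  have "(\<lambda>\<omega>. \<phi> s \<omega> \<bullet> (S s \<omega> - S (s - 1) \<omega>)) \<in> borel_measurable M" if "s \<in> {1..t}" for s
  proof -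
    have [measurable]: "\<phi> s \<in> borel_measurable M" "S s \<in> borel_measurable M" "S (s - 1) \<in> borel_measurable M"
      using that assms(3) by (auto intro!: S strategy_measurable[OF assms(2)])
    show ?thesis by measurable
  qed
  then show ?thesis unfolding wealth_def[abs_def] by (intro borel_measurable_add borel_measurable_sum) auto
qed

lemma reduce_strategy:
  assumes "\<phi> \<in> strategies F T"
  shows "\<exists>\<psi>. \<psi> \<in> strategies F T \<and> (\<forall>t\<in>{1..T}. \<psi> t \<in> reduced t) \<and>
    (\<forall>S\<in>SS. \<forall>t\<le>T. AE \<omega> in M. wealth S w \<psi> t \<omega> = wealth S w \<phi> t \<omega>)"
proof -
  have "\<exists>g. g \<in> null_positions M (F (t - 1)) (\<lambda>\<omega>. R t \<omega> - R (t - 1) \<omega>) \<and> (\<lambda>\<omega>. \<phi> t \<omega> - g \<omega>) \<in> reduced t"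
    if t: "t \<in> {1..T}" for t
  proof -
    have "\<phi> t \<in> borel_measurable (F (t - 1))" using assms t by (auto simp: strategies_def)
    from finite_measure_axioms sub_pred[OF t] this
    obtain g where "g \<in> null_positions M (F (t - 1)) (\<lambda>\<omega>. R t \<omega> - R (t - 1) \<omega>)" "(\<lambda>\<omega>. \<phi> t \<omega> - g \<omega>) \<in> reduced t"
      by (rule reduced_positions_decomposition)
    then show ?thesis by blast
  qed
  then have "\<forall>t\<in>{1..T}. \<exists>g. g \<in> null_positions M (F (t - 1)) (\<lambda>\<omega>. R t \<omega> - R (t - 1) \<omega>) \<and> (\<lambda>\<omega>. \<phi> t \<omega> - g \<omega>) \<in> reduced t"
    by (rule ballI)
  from bchoice[OF this] obtain g where g:
    "\<And>t. t \<in> {1..T} \<Longrightarrow> g t \<in> null_positions M (F (t - 1)) (\<lambda>\<omega>. R t \<omega> - R (t - 1) \<omega>)"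
    "\<And>t. t \<in> {1..T} \<Longrightarrow> (\<lambda>\<omega>. \<phi> t \<omega> - g t \<omega>) \<in> reduced t" by blast
  define \<psi> where "\<psi> t \<omega> = \<phi> t \<omega> - g t \<omega>" for t \<omega>
  have red: "\<psi> t \<in> reduced t" if "t \<in> {1..T}" for t using g(2)[OF that] by (simp add: \<psi>_def[abs_def])
  have "\<psi> \<in> strategies F T" using red by (auto simp: strategies_def reduced_positions_def)
  moreover have "AE \<omega> in M. wealth S w \<psi> t \<omega> = wealth S w \<phi> t \<omega>" if S: "S \<in> SS" and t: "t \<le> T" for S t
  proof (rule wealth_cong_AE)
    fix s assume "s \<in> {1..t}"
    then have s: "s \<in> {1..T}" using t by auto
    have "AE \<omega> in M. g s \<omega> \<bullet> (S s \<omega> - S (s - 1) \<omega>) = 0"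
      using g(1)[OF s] by (intro transfer[OF S s]) (auto simp: null_positions_def)
    then show "AE \<omega> in M. \<psi> s \<omega> \<bullet> (S s \<omega> - S (s - 1) \<omega>) = \<phi> s \<omega> \<bullet> (S s \<omega> - S (s - 1) \<omega>)"
      by eventually_elim (simp add: \<psi>_def inner_diff_left)
  qed
  ultimately show ?thesis using red by blast
qed

text \<open>If wealth at time \<open>s\<close> is bounded above along the sequence, nonnegativity at
  time \<open>s + 1\<close> bounds the next gain from below, so the next positions are bounded by
  one-step no-arbitrage; by Cauchy-Schwarz the next wealth is then bounded above as well. The
  induction starts from the constant \<open>w0\<close>.\<close>

lemma reduced_strategies_bounded:
  fixes \<psi> :: "nat \<Rightarrow> nat \<Rightarrow> 'w \<Rightarrow> 'v"
  assumes \<psi>: "\<And>n. \<psi> n \<in> Lpos M F T w0 R" and red: "\<And>n t. t \<in> {1..T} \<Longrightarrow> \<psi> n t \<in> reduced t"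
    and t: "t \<in> {1..T}"
  shows "AE \<omega> in M. \<exists>K. \<forall>n. norm (\<psi> n t \<omega>) \<le> K"
proof -
  have pos: "AE \<omega> in M. 0 \<le> wealth R w0 (\<psi> n) s \<omega>" if "s \<le> T" for n s
    using \<psi>[of n] that by (auto simp: Lpos_def)
  have step: "AE \<omega> in M. \<exists>K. \<forall>n. norm (\<psi> n (Suc s) \<omega>) \<le> K"
    if s: "Suc s \<le> T" and b: "AE \<omega> in M. \<exists>K. \<forall>n. wealth R w0 (\<psi> n) s \<omega> \<le> K" for s
  proof -
    have s1: "Suc s \<in> {1..T}" using s by simp
    \<comment> \<open>An arbitrary pointwise bound, which enters only almost sure
      inequalities.\<close>
    define w where "w \<omega> = (SOME K. \<forall>n. wealth R w0 (\<psi> n) s \<omega> \<le> K)" for \<omega>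
    have wb: "AE \<omega> in M. \<forall>n. wealth R w0 (\<psi> n) s \<omega> \<le> w \<omega>"
      using b unfolding w_def by eventually_elim (rule someI_ex)
    show ?thesis
    proof (rule reduced_positions_bounded[where h="\<lambda>n. \<psi> n (Suc s)" and G="F (Suc s - 1)"
          and X="\<lambda>\<omega>. R (Suc s) \<omega> - R (Suc s - 1) \<omega>", OF prob_space_axioms sub_pred[OF s1]])
      show "\<psi> n (Suc s) \<in> reduced (Suc s)" for n by (rule red[OF s1])
      show "AE \<omega> in M. g \<omega> \<bullet> (R (Suc s) \<omega> - R (Suc s - 1) \<omega>) = 0"
        if "g \<in> borel_measurable (F (Suc s - 1))" "AE \<omega> in M. 0 \<le> g \<omega> \<bullet> (R (Suc s) \<omega> - R (Suc s - 1) \<omega>)" for g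
        by (rule NA_one_step[OF R(2) s1 that])
      fix n
      show "AE \<omega> in M. - w \<omega> \<le> \<psi> n (Suc s) \<omega> \<bullet> (R (Suc s) \<omega> - R (Suc s - 1) \<omega>)"
        using wb pos[OF s, of n]
      proof eventually_elim
        case (elim \<omega>)
        have "wealth R w0 (\<psi> n) s \<omega> \<le> w \<omega>" using elim(1) by blast
        then show ?case using elim(2) by (simp add: wealth_Suc)
      qed
    qed
  qed
  have wealth_bounded: "AE \<omega> in M. \<exists>K. \<forall>n. wealth R w0 (\<psi> n) s \<omega> \<le> K" if "s \<le> T" for s
    using that
  proof (induction s)
    case 0
    then show ?case by (auto simp: wealth_def)
  next
    case (Suc s)
    then have b: "AE \<omega> in M. \<exists>K. \<forall>n. wealth R w0 (\<psi> n) s \<omega> \<le> K" by simp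
    from b step[OF Suc.prems b] show ?case
    proof eventually_elim
      case (elim \<omega>)
      then obtain K K' where K: "\<And>n. wealth R w0 (\<psi> n) s \<omega> \<le> K" "\<And>n. norm (\<psi> n (Suc s) \<omega>) \<le> K'" by blast
      have "wealth R w0 (\<psi> n) (Suc s) \<omega> \<le> K + K' * norm (R (Suc s) \<omega> - R s \<omega>)" for n
      proof -
        have "\<psi> n (Suc s) \<omega> \<bullet> (R (Suc s) \<omega> - R s \<omega>) \<le> norm (\<psi> n (Suc s) \<omega>) * norm (R (Suc s) \<omega> - R s \<omega>)"
          by (rule norm_cauchy_schwarz)
        also have "\<dots> \<le> K' * norm (R (Suc s) \<omega> - R s \<omega>)" by (intro mult_right_mono K) simp
        finally show ?thesis using K(1)[of n] by (simp add: wealth_Suc)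
      qed
      then show ?case by blast
    qed
  qed
  obtain s where "t = Suc s" "Suc s \<le> T" using t by (cases t) auto
  then show ?thesis using step[of s] wealth_bounded[of s] by simp
qed

text \<open>A supremum of convex costs is convex, so its sublevel sets are closed under midpoints;
  Fatou together with lower semicontinuity makes it lower semicontinuous along almost surely
  convergent strategies. The supremum over models is taken of integrals, that is of numbers, so its
  size raises no measurability question.\<close>

lemma exists_minimal_strategy:
  fixes V :: "real \<Rightarrow> ennreal"
  assumes V[measurable]: "V \<in> borel_measurable borel"
    and V_mid: "\<And>x y. 2 * V ((x + y) / 2) \<le> V x + V y"
    and V_lsc: "\<And>x X. X \<longlonglongrightarrow> x \<Longrightarrow> V x \<le> liminf (\<lambda>n. V (X n))"
    and w0: "0 \<le> w0"
  shows "\<exists>\<phi>\<in>Adm M F T SS w0. \<forall>\<psi>\<in>Adm M F T SS w0.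
    (SUP S\<in>SS. \<integral>\<^sup>+\<omega>. V (wealth S w0 \<phi> T \<omega>) \<partial>M) \<le> (SUP S\<in>SS. \<integral>\<^sup>+\<omega>. V (wealth S w0 \<psi> T \<omega>) \<partial>M)"
proof -
  define A where "A = Adm M F T SS w0"
  define J where "J \<phi> = (SUP S\<in>SS. \<integral>\<^sup>+\<omega>. V (wealth S w0 \<phi> T \<omega>) \<partial>M)" for \<phi>
  define c where "c = (INF \<phi>\<in>A. J \<phi>)"
  have A_iff: "\<phi> \<in> A \<longleftrightarrow> \<phi> \<in> strategies F T \<and> (\<forall>S\<in>SS. \<forall>t\<le>T. AE \<omega> in M. 0 \<le> wealth S w0 \<phi> t \<omega>)" for \<phi>
    using R(1) by (auto simp: A_def Adm_def Lpos_def)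
  have "(\<lambda>_ _. 0) \<in> A" using w0 by (auto simp: A_iff strategies_def wealth_def)
  then have "A \<noteq> {}" by auto
  have "\<exists>\<phi>\<in>A. J \<phi> \<le> c + ennreal (1 / Suc n)" for n
  proof (cases "c = top")
    case True
    then show ?thesis using \<open>A \<noteq> {}\<close> by auto
  next
    case False
    then have "c < c + ennreal (1 / Suc n)" by (cases c) (auto simp flip: ennreal_plus simp: ennreal_less_iff)
    then obtain \<phi> where "\<phi> \<in> A" "J \<phi> < c + ennreal (1 / Suc n)"
      using INF_less_iff[of J A "c + ennreal (1 / Suc n)"] unfolding c_def[symmetric] by blast
    then show ?thesis by (intro bexI[of _ \<phi>] less_imp_le)
  qed
  then obtain \<phi> where \<phi>: "\<And>n. \<phi> n \<in> A" "\<And>n. J (\<phi> n) \<le> c + ennreal (1 / Suc n)" by metis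
  \<comment> \<open>Raw near-minimisers may contain arbitrarily large null positions; reduction
    removes these without changing any wealth almost surely, hence any cost.\<close>
  have "\<forall>n. \<exists>\<psi>. \<psi> \<in> strategies F T \<and> (\<forall>t\<in>{1..T}. \<psi> t \<in> reduced t) \<and>
    (\<forall>S\<in>SS. \<forall>t\<le>T. AE \<omega> in M. wealth S w0 \<psi> t \<omega> = wealth S w0 (\<phi> n) t \<omega>)"
    using \<phi>(1) by (intro allI reduce_strategy) (simp add: A_iff)
  from choice[OF this] obtain \<psi> where \<psi>: "\<And>n. \<psi> n \<in> strategies F T" "\<And>n t. t \<in> {1..T} \<Longrightarrow> \<psi> n t \<in> reduced t"
    "\<And>n S t. S \<in> SS \<Longrightarrow> t \<le> T \<Longrightarrow> AE \<omega> in M. wealth S w0 (\<psi> n) t \<omega> = wealth S w0 (\<phi> n) t \<omega>" by blast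
  have \<psi>A: "\<psi> n \<in> A" for n
  proof -
    have "AE \<omega> in M. 0 \<le> wealth S w0 (\<psi> n) t \<omega>" if "S \<in> SS" "t \<le> T" for S t
    proof -
      have "AE \<omega> in M. 0 \<le> wealth S w0 (\<phi> n) t \<omega>" using \<phi>(1)[of n] that by (auto simp: A_iff)
      then show ?thesis using \<psi>(3)[OF that, of n] by eventually_elim simp
    qed
    then show ?thesis using \<psi>(1) by (auto simp: A_iff)
  qed
  have \<psi>J: "J (\<psi> n) \<le> c + ennreal (1 / Suc n)" for n
  proof -
    have "J (\<psi> n) = J (\<phi> n)" unfolding J_def
    proof (rule SUP_cong[OF refl])
      fix S assume S: "S \<in> SS"
      have "AE \<omega> in M. V (wealth S w0 (\<psi> n) T \<omega>) = V (wealth S w0 (\<phi> n) T \<omega>)"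
        using \<psi>(3)[OF S order_refl, of n] by eventually_elim simp
      then show "(\<integral>\<^sup>+\<omega>. V (wealth S w0 (\<psi> n) T \<omega>) \<partial>M) = (\<integral>\<^sup>+\<omega>. V (wealth S w0 (\<phi> n) T \<omega>) \<partial>M)"
        by (rule nn_integral_cong_AE)
    qed
    then show ?thesis using \<phi>(2) by simp
  qed
  have \<psi>M[measurable]: "\<psi> n t \<in> borel_measurable M" if "t \<in> {1..T}" for n t
    using strategy_measurable[OF \<psi>(1) that] .
  have \<psi>L: "\<psi> n \<in> Lpos M F T w0 R" for n using \<psi>A[of n] R(1) by (auto simp: A_def Adm_def)
  \<comment> \<open>One measurable bound for all periods and all indices. The supremum is taken in
    \<open>ennreal\<close>, and \<open>enn2real\<close> replaces infinity by 0, which matters only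
    on a null set.\<close>
  define K where "K \<omega> = (\<Sum>t\<in>{1..T}. enn2real (SUP n. ennreal (norm (\<psi> n t \<omega>))))" for \<omega>
  have Km: "K \<in> borel_measurable M" unfolding K_def by (intro borel_measurable_sum) measurable
  have \<psi>K: "AE \<omega> in M. norm (\<psi> n t \<omega>) \<le> K \<omega>" if t: "t \<in> {1..T}" for n t
  proof -
    have "AE \<omega> in M. \<exists>K. \<forall>n. norm (\<psi> n t \<omega>) \<le> K"
      by (rule reduced_strategies_bounded[OF \<psi>L _ t]) (rule \<psi>(2))
    then show ?thesis
    proof eventually_elim
      case (elim \<omega>)
      then obtain B where B: "\<And>n. norm (\<psi> n t \<omega>) \<le> B" by blast
      have "(SUP n. ennreal (norm (\<psi> n t \<omega>))) \<le> ennreal B" by (intro SUP_least ennreal_leI B)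
      then have fin: "(SUP n. ennreal (norm (\<psi> n t \<omega>))) < top" by (rule le_less_trans) simp
      have "norm (\<psi> n t \<omega>) = enn2real (ennreal (norm (\<psi> n t \<omega>)))" by simp
      also have "\<dots> \<le> enn2real (SUP n. ennreal (norm (\<psi> n t \<omega>)))"
        by (rule enn2real_mono[OF _ fin]) (rule SUP_upper, simp)
      also have "\<dots> \<le> K \<omega>" unfolding K_def by (rule member_le_sum[OF t]) auto
      finally show ?case .
    qed
  qed
  \<comment> \<open>Boundedness is recorded here through \<open>K\<close>, and the cost level
    decreases to the infimum. The \<open>n\<close>-th reduced near-minimiser shows that the set is
    nonempty.\<close>
  define C where "C n = {f \<in> A. (\<forall>t\<in>{1..T}. AE \<omega> in M. norm (f t \<omega>) \<le> K \<omega>) \<and> J f \<le> c + ennreal (1 / Suc n)}" for n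
  obtain f where f: "\<And>n. f n \<in> C n" "AE \<omega> in M. \<forall>t\<in>{1..T}. convergent (\<lambda>n. f n t \<omega>)"
  proof (rule convergent_selection_bounded[of M "{1..T}" C K])
    show "finite_measure M" by unfold_locales
    show "K \<in> borel_measurable M" by fact
    show "C (Suc n) \<subseteq> C n" for n
    proof -
      have "c + ennreal (1 / Suc (Suc n)) \<le> c + ennreal (1 / Suc n)"
        by (intro add_left_mono ennreal_leI) (simp add: field_simps)
      then show ?thesis by (auto simp: C_def intro: order_trans)
    qed
    show "(\<lambda>t \<omega>. (1/2) *\<^sub>R (f t \<omega> + g t \<omega>)) \<in> C n" (is "?m \<in> _") if f: "f \<in> C n" and g: "g \<in> C n" for n f g
    proof -
      have fA: "f \<in> A" and gA: "g \<in> A" using f g by (auto simp: C_def)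
      have mst: "?m \<in> strategies F T" using fA gA
        unfolding A_iff strategies_def by (auto intro!: borel_measurable_scaleR borel_measurable_add)
      have "AE \<omega> in M. 0 \<le> wealth S w0 ?m t \<omega>" if "S \<in> SS" "t \<le> T" for S t
      proof -
        have "AE \<omega> in M. 0 \<le> wealth S w0 f t \<omega>" "AE \<omega> in M. 0 \<le> wealth S w0 g t \<omega>"
          using fA gA that by (auto simp: A_iff)
        then show ?thesis unfolding wealth_midpoint by eventually_elim simp
      qed
      then have mA: "?m \<in> A" using mst by (auto simp: A_iff)
      have mK: "AE \<omega> in M. norm (?m t \<omega>) \<le> K \<omega>" if "t \<in> {1..T}" for t
      proof -
        have "AE \<omega> in M. norm (f t \<omega>) \<le> K \<omega>" "AE \<omega> in M. norm (g t \<omega>) \<le> K \<omega>"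
          using f g that by (auto simp: C_def)
        then show ?thesis
        proof eventually_elim
          case (elim \<omega>)
          then show ?case using norm_triangle_ineq[of "f t \<omega>" "g t \<omega>"] by simp
        qed
      qed
      have "J ?m \<le> c + ennreal (1 / Suc n)" unfolding J_def
      proof (rule SUP_least)
        fix S assume S: "S \<in> SS"
        have [measurable]: "wealth S w0 f T \<in> borel_measurable M" "wealth S w0 g T \<in> borel_measurable M"
          using fA gA by (auto intro!: wealth_measurable[OF S] simp: A_iff)
        let ?I = "\<lambda>\<phi>. \<integral>\<^sup>+\<omega>. V (wealth S w0 \<phi> T \<omega>) \<partial>M"
        \<comment> \<open>Convexity is used in doubled form to avoid halving in
          \<open>ennreal\<close>; the factor 2 is cancelled at the end.\<close>
        have "2 * ?I ?m = (\<integral>\<^sup>+\<omega>. 2 * V ((wealth S w0 f T \<omega> + wealth S w0 g T \<omega>) / 2) \<partial>M)"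
          unfolding wealth_midpoint by (rule nn_integral_cmult[symmetric]) measurable
        also have "\<dots> \<le> (\<integral>\<^sup>+\<omega>. V (wealth S w0 f T \<omega>) + V (wealth S w0 g T \<omega>) \<partial>M)"
          by (intro nn_integral_mono V_mid)
        also have "\<dots> = ?I f + ?I g" by (rule nn_integral_add) measurable
        also have "\<dots> \<le> J f + J g" unfolding J_def by (intro add_mono SUP_upper S)
        also have "\<dots> \<le> (c + ennreal (1 / Suc n)) + (c + ennreal (1 / Suc n))"
          using f g by (intro add_mono) (auto simp: C_def)
        also have "\<dots> = 2 * (c + ennreal (1 / Suc n))" by (simp add: mult_2)
        finally show "?I ?m \<le> c + ennreal (1 / Suc n)" by (subst (asm) ennreal_mult_le_mult_iff) auto
      qed
      then show ?thesis using mA mK by (auto simp: C_def)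
    qed
    show "f t \<in> borel_measurable M" if "f \<in> C n" "t \<in> {1..T}" for n f t
      using that by (intro strategy_measurable) (auto simp: C_def A_iff)
    show "AE \<omega> in M. norm (f t \<omega>) \<le> K \<omega>" if "f \<in> C n" "t \<in> {1..T}" for n f t
      using that by (auto simp: C_def)
    show "C n \<noteq> {}" for n using \<psi>A[of n] \<psi>J[of n] \<psi>K by (auto simp: C_def)
  next
    fix f assume "\<And>n. f n \<in> C n" "AE \<omega> in M. \<forall>t\<in>{1..T}. convergent (\<lambda>n. f n t \<omega>)"
    then show thesis by (rule that)
  qed simp
  have fA: "f n \<in> A" and fJ: "J (f n) \<le> c + ennreal (1 / Suc n)" for n using f(1)[of n] by (auto simp: C_def)
  define L where "L t \<omega> = lim (\<lambda>n. f n t \<omega>)" for t \<omega>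
  have Lst: "L \<in> strategies F T"
    using fA by (auto simp: strategies_def L_def[abs_def] A_iff intro!: borel_measurable_lim_metric)
  \<comment> \<open>The null set comes from the strategies alone and so is the same for every
    \<open>S\<close>.\<close>
  have conv: "AE \<omega> in M. \<forall>t\<le>T. (\<lambda>n. wealth S w0 (f n) t \<omega>) \<longlonglongrightarrow> wealth S w0 L t \<omega>" for S
    using f(2)
  proof eventually_elim
    case (elim \<omega>)
    have "(\<lambda>n. f n s \<omega>) \<longlonglongrightarrow> L s \<omega>" if "s \<in> {1..T}" for s
      using elim that by (simp add: L_def convergent_LIMSEQ_iff)
    then show ?case unfolding wealth_def by (auto intro!: tendsto_intros)
  qed
  have LA: "L \<in> A"
  proof -
    have "AE \<omega> in M. 0 \<le> wealth S w0 L t \<omega>" if "S \<in> SS" "t \<le> T" for S t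
    proof -
      have "AE \<omega> in M. \<forall>n. 0 \<le> wealth S w0 (f n) t \<omega>"
        using fA that by (subst AE_all_countable) (auto simp: A_iff)
      then show ?thesis using conv[of S]
        by eventually_elim (use that in \<open>auto intro: LIMSEQ_le_const\<close>)
    qed
    then show ?thesis using Lst by (auto simp: A_iff)
  qed
  have "J L \<le> c" unfolding J_def
  proof (rule SUP_least)
    fix S assume S: "S \<in> SS"
    have [measurable]: "wealth S w0 (f n) T \<in> borel_measurable M" for n
      using fA[of n] by (intro wealth_measurable[OF S]) (auto simp: A_iff)
    have "(\<integral>\<^sup>+\<omega>. V (wealth S w0 L T \<omega>) \<partial>M) \<le> (\<integral>\<^sup>+\<omega>. liminf (\<lambda>n. V (wealth S w0 (f n) T \<omega>)) \<partial>M)"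
      by (rule nn_integral_mono_AE) (use conv[of S] in eventually_elim, use V_lsc in auto)
    also have "\<dots> \<le> liminf (\<lambda>n. \<integral>\<^sup>+\<omega>. V (wealth S w0 (f n) T \<omega>) \<partial>M)"
      by (rule nn_integral_liminf) measurable
    also have "\<dots> \<le> liminf (\<lambda>n. c + ennreal (1 / Suc n))"
    proof (intro Liminf_mono always_eventually allI)
      fix n
      have "(\<integral>\<^sup>+\<omega>. V (wealth S w0 (f n) T \<omega>) \<partial>M) \<le> J (f n)" unfolding J_def by (rule SUP_upper[OF S])
      then show "(\<integral>\<^sup>+\<omega>. V (wealth S w0 (f n) T \<omega>) \<partial>M) \<le> c + ennreal (1 / Suc n)" using fJ[of n] by (rule order_trans)
    qed
    also have "\<dots> = c + ennreal 0"
      by (intro lim_imp_Liminf tendsto_add tendsto_const tendsto_ennrealI LIMSEQ_Suc[OF lim_1_over_n]) auto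
    finally show "(\<integral>\<^sup>+\<omega>. V (wealth S w0 L T \<omega>) \<partial>M) \<le> c" by simp
  qed
  moreover have "c \<le> J \<psi>" if "\<psi> \<in> A" for \<psi> unfolding c_def by (rule INF_lower[OF that])
  ultimately show ?thesis using LA unfolding A_def J_def by (meson order_trans)
qed

end

section \<open>Translating expected utility into expected cost\<close>

text \<open>The upper limit in \<open>utility\<close> ignores the value at the point itself, which
  is below the level by choice of the point. Openness yields both Borel measurability of
  \<open>U\<close> and lower semicontinuity of the cost.\<close>

lemma utility_open_sublevel:
  assumes "utility U"
  shows "open {x. U x < a}"
proof (subst open_subopen, safe)
  fix x assume x: "U x < a"
  have "Limsup (at x) U < a" using assms x unfolding utility_def by (metis le_less_trans)
  then have "\<forall>\<^sub>F y in at x. U y < a" by (rule Limsup_lessD)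
  with x have "\<forall>\<^sub>F y in nhds x. U y < a" by (simp add: eventually_nhds_conv_at)
  then show "\<exists>T. open T \<and> x \<in> T \<and> T \<subseteq> {x. U x < a}" unfolding eventually_nhds by auto
qed

text \<open>A Galois connection between utilities and costs. Since \<open>b\<close> is at most
  \<open>L\<close>, truncating \<open>ereal L - b\<close> at 0 loses nothing, and infinite values
  are covered on both sides.\<close>

lemma le_diff_enn2ereal_iff:
  assumes "b \<le> ereal L"
  shows "b \<le> ereal L - enn2ereal v \<longleftrightarrow> v \<le> e2ennreal (ereal L - b)"
proof (cases b)
  case (real r)
  then have r: "r \<le> L" using assms by simp
  show ?thesis
  proof (cases v)
    case (real x)
    then have "v \<le> e2ennreal (ereal L - b) \<longleftrightarrow> x \<le> L - r"
      using r \<open>b = ereal r\<close> by (simp add: e2ennreal_ereal ennreal_le_iff)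
    moreover have "b \<le> ereal L - enn2ereal v \<longleftrightarrow> r \<le> L - x"
      using real \<open>b = ereal r\<close> by simp
    ultimately show ?thesis by auto
  qed (use \<open>b = ereal r\<close> in \<open>simp add: e2ennreal_ereal top_unique\<close>)
next
  case MInf
  then show ?thesis by (simp add: e2ennreal_infty)
qed (use assms in simp)

text \<open>The upper bound gives the positive part finite expectation, so the convention for two
  infinite parts is never triggered. The formula follows by integrating \<open>pw\<close>, an
  identity of sums in which no difference of infinite values occurs.\<close>

lemma eexp_eq_diff:
  assumes "prob_space M" and U[measurable]: "U \<in> borel_measurable borel" and le: "\<And>x. U x \<le> ereal L" and L: "0 \<le> L"
    and Y[measurable]: "Y \<in> borel_measurable M"
  shows "eexp M (\<lambda>\<omega>. U (Y \<omega>)) = ereal L - enn2ereal (\<integral>\<^sup>+\<omega>. e2ennreal (ereal L - U (Y \<omega>)) \<partial>M)"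
proof -
  interpret prob_space M by fact
  define p where "p = (\<integral>\<^sup>+\<omega>. e2ennreal (U (Y \<omega>)) \<partial>M)"
  define n where "n = (\<integral>\<^sup>+\<omega>. e2ennreal (- U (Y \<omega>)) \<partial>M)"
  define v where "v = (\<integral>\<^sup>+\<omega>. e2ennreal (ereal L - U (Y \<omega>)) \<partial>M)"
  have pw: "e2ennreal (ereal L - U x) + e2ennreal (U x) = ennreal L + e2ennreal (- U x)" for x
  proof (cases "U x")
    case (real r)
    then have "r \<le> L" using le[of x] by simp
    then show ?thesis using real L
      by (cases "0 \<le> r") (auto simp: e2ennreal_ereal e2ennreal_neg ennreal_neg simp flip: ennreal_plus)
  next
    case PInf
    then show ?thesis using le[of x] by simp
  next
    case MInf
    then show ?thesis by (simp add: e2ennreal_infty)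
  qed
  have "p \<le> (\<integral>\<^sup>+\<omega>. ennreal L \<partial>M)"
    unfolding p_def by (intro nn_integral_mono) (metis le e2ennreal_mono e2ennreal_ereal)
  then have "p \<le> ennreal L" by (simp add: emeasure_space_1)
  then obtain p' where p': "p = ennreal p'" "0 \<le> p'"
    by (cases p) (auto simp: top_unique)
  have "v + p = (\<integral>\<^sup>+\<omega>. e2ennreal (ereal L - U (Y \<omega>)) + e2ennreal (U (Y \<omega>)) \<partial>M)"
    unfolding v_def p_def by (rule nn_integral_add[symmetric]) measurable
  also have "\<dots> = (\<integral>\<^sup>+\<omega>. ennreal L + e2ennreal (- U (Y \<omega>)) \<partial>M)" unfolding pw ..
  also have "\<dots> = (\<integral>\<^sup>+\<omega>. ennreal L \<partial>M) + n"
    unfolding n_def by (rule nn_integral_add) measurable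
  finally have vn: "v + p = ennreal L + n" by (simp add: emeasure_space_1)
  have "eexp M (\<lambda>\<omega>. U (Y \<omega>)) = enn2ereal p - enn2ereal n"
    unfolding eexp_def Let_def p_def[symmetric] n_def[symmetric] using p' by simp
  also have "\<dots> = ereal L - enn2ereal v"
  proof (cases n)
    case (real n')
    then have "v + p = ennreal (L + n')" using vn L by simp
    then obtain v' where v': "v = ennreal v'" "0 \<le> v'" by (cases v) auto
    then have "ennreal (v' + p') = ennreal (L + n')" using vn real p' L by simp
    then have "v' + p' = L + n'" using v' p' real L by (subst (asm) ennreal_inj) auto
    then show ?thesis using v' p' real by simp
  next
    case top
    then have "v + p = top" using vn by simp
    then have "v = top" using p' by (cases v) (auto simp flip: ennreal_plus)
    then show ?thesis using top p' by simp
  qed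
  finally show ?thesis unfolding v_def .
qed

theorem theorem3p2:
  fixes M :: "'w measure" and F :: "nat \<Rightarrow> 'w measure" and T :: nat
    and SS :: "(nat \<Rightarrow> 'w \<Rightarrow> 'v::euclidean_space) set"
    and U :: "real \<Rightarrow> ereal" and w0 :: real
  assumes P: "prob_space M"
    and complete: "complete_measure M"
    and filt_sub: "\<forall>t\<le>T. subalgebra M (F t)"
    and filt_mono: "\<forall>s t. s \<le> t \<and> t \<le> T \<longrightarrow> sets (F s) \<subseteq> sets (F t)"
    and filt_null: "\<forall>t\<le>T. null_sets M \<subseteq> sets (F t)"
    and adapted: "\<forall>S\<in>SS. \<forall>t\<le>T. S t \<in> borel_measurable (F t)"
    and Sstar_ne: "Sstar M F T SS \<noteq> {}"
    and U_util: "utility U"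
    and U_dom: "interior {x. U x \<noteq> - \<infinity>} = {0<..}"
    and w0_pos: "w0 > 0"
    and U_top: "\<exists>L. (U \<longlongrightarrow> L) at_top \<and> L < \<infinity>"
  shows "\<exists>\<phi>\<in>Adm M F T SS w0.
           uval M F T SS U w0 = (INF S\<in>SS. eexp M (\<lambda>\<omega>. U (wealth S w0 \<phi> T \<omega>)))
         \<and> uval M F T SS U w0 < \<infinity>"
proof -
  obtain R where R: "R \<in> SS" "NA M F T R"
    "\<And>S t. S \<in> SS \<Longrightarrow> t \<in> {1..T} \<Longrightarrow> AE \<omega> in M. Dset M F S t \<omega> \<subseteq> Dset M F R t \<omega>"
    using Sstar_ne unfolding Sstar_def by blast
  have SM: "S t \<in> borel_measurable M" if "S \<in> SS" "t \<le> T" for S t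
    using filt_sub adapted that by (intro measurable_from_subalg[of M "F t"]) auto
  interpret prob_space M by fact
  interpret dominated_market M F T SS R
  proof
    fix S t and h :: "'w \<Rightarrow> 'v"
    assume S: "S \<in> SS" and t: "t \<in> {1..T}" and h: "h \<in> borel_measurable (F (t - 1))"
      and orth: "AE \<omega> in M. h \<omega> \<bullet> (R t \<omega> - R (t - 1) \<omega>) = 0"
    show "AE \<omega> in M. h \<omega> \<bullet> (S t \<omega> - S (t - 1) \<omega>) = 0"
      by (rule orthogonal_increment_transfer[OF P _ _ _ _ _ R(3)[OF S t] h orth])
        (use t filt_sub SM[OF S] SM[OF R(1)] in auto)
  qed (use R filt_sub adapted in auto)

  \<comment> \<open>Raising the limit to at least 0 provides the nonnegative bound that
    \<open>eexp_eq_diff\<close> asks for and turns a limit of \<open>-\<infinity>\<close> into a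
    real bound.\<close>
  obtain L :: real where L: "0 \<le> L" "\<And>x. U x \<le> ereal L"
  proof -
    obtain l where l: "(U \<longlongrightarrow> l) at_top" "l < \<infinity>" using U_top by blast
    have "U x \<le> l" for x
    proof (rule tendsto_lowerbound[OF l(1)])
      have "mono U" using U_util by (simp add: utility_def)
      then show "\<forall>\<^sub>F y in at_top. U x \<le> U y"
        by (intro eventually_mono[OF eventually_ge_at_top[of x]]) (rule monoD)
    qed simp
    moreover have "l \<le> ereal (max 0 (real_of_ereal l))" using l(2) by (cases l) auto
    ultimately show ?thesis using that[of "max 0 (real_of_ereal l)"] by (auto intro: order_trans)
  qed
  have Um[measurable]: "U \<in> borel_measurable borel"
    by (rule borel_measurableI_less) (simp add: utility_open_sublevel[OF U_util])
  have Uinf: "U x \<noteq> \<infinity>" for x using U_util by (simp add: utility_def)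
  define V where "V x = e2ennreal (ereal L - U x)" for x
  have Vm[measurable]: "V \<in> borel_measurable borel" unfolding V_def by measurable
  have V_mid: "2 * V ((x + y) / 2) \<le> V x + V y" for x y
  proof (cases "U x = -\<infinity> \<or> U y = -\<infinity>")
    case True
    then show ?thesis by (auto simp: V_def e2ennreal_infty)
  next
    case False
    then obtain a b where ab: "U x = ereal a" "U y = ereal b"
      using Uinf[of x] Uinf[of y] by (cases "U x"; cases "U y") auto
    have "ereal (1/2) * U x + ereal (1 - 1/2) * U y \<le> U (1/2 * x + (1 - 1/2) * y)"
      using U_util unfolding utility_def by (metis half_gt_zero_iff less_numeral_extra(1) field_sum_of_halves less_add_same_cancel1)
    also have "1/2 * x + (1 - 1/2) * y = (x + y) / 2" by (simp add: field_simps)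
    finally have "ereal ((a + b) / 2) \<le> U ((x + y) / 2)" by (simp add: ab field_simps)
    moreover then obtain m where m: "U ((x + y) / 2) = ereal m"
      using Uinf[of "(x + y) / 2"] by (cases "U ((x + y) / 2)") auto
    ultimately have "(a + b) / 2 \<le> m" by simp
    moreover have "a \<le> L" "b \<le> L" "m \<le> L" using L(2)[of x] L(2)[of y] L(2)[of "(x + y) / 2"] ab m by auto
    ultimately have "ennreal (2 * (L - m)) \<le> ennreal ((L - a) + (L - b))" by (intro ennreal_leI) argo
    moreover have "2 * V ((x + y) / 2) = ennreal (2 * (L - m))"
      using \<open>m \<le> L\<close> by (subst ennreal_mult) (auto simp: V_def m e2ennreal_ereal)
    moreover have "V x + V y = ennreal ((L - a) + (L - b))"
      using \<open>a \<le> L\<close> \<open>b \<le> L\<close> by (subst ennreal_plus) (auto simp: V_def ab e2ennreal_ereal)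
    ultimately show ?thesis by simp
  qed
  have V_lsc: "V x \<le> liminf (\<lambda>n. V (X n))" if X: "X \<longlonglongrightarrow> x" for x X
  proof (unfold le_Liminf_iff, intro allI impI)
    fix y assume y: "y < V x"
    \<comment> \<open>Lower semicontinuity of \<open>V\<close> is openness of the sublevel sets of
      \<open>U\<close> read through \<open>L - U\<close>; the level \<open>y\<close> is finite
      because it lies strictly below \<open>V x\<close>.\<close>
    have less_iff: "y < V z \<longleftrightarrow> U z < ereal L - enn2ereal y" for z
    proof -
      obtain y' where y': "y = ennreal y'" "0 \<le> y'" using y by (cases y) auto
      show ?thesis
      proof (cases "U z")
        case (real r)
        then have "r \<le> L" using L(2)[of z] by simp
        then show ?thesis using real y' by (auto simp: V_def e2ennreal_ereal ennreal_less_iff)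
      qed (use y' Uinf in \<open>auto simp: V_def e2ennreal_infty\<close>)
    qed
    have "\<forall>\<^sub>F z in nhds x. U z < ereal L - enn2ereal y"
      using eventually_nhds_in_open[OF utility_open_sublevel[OF U_util], of x] y unfolding less_iff by auto
    then show "\<forall>\<^sub>F n in sequentially. y < V (X n)"
      unfolding less_iff using X by (rule eventually_compose_filterlim)
  qed
  obtain \<phi> where \<phi>: "\<phi> \<in> Adm M F T SS w0"
    and opt: "\<And>\<psi>. \<psi> \<in> Adm M F T SS w0 \<Longrightarrow>
      (SUP S\<in>SS. \<integral>\<^sup>+\<omega>. V (wealth S w0 \<phi> T \<omega>) \<partial>M) \<le> (SUP S\<in>SS. \<integral>\<^sup>+\<omega>. V (wealth S w0 \<psi> T \<omega>) \<partial>M)"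
    using exists_minimal_strategy[OF Vm V_mid V_lsc less_imp_le[OF w0_pos]] by blast
  define J where "J \<psi> = (INF S\<in>SS. eexp M (\<lambda>\<omega>. U (wealth S w0 \<psi> T \<omega>)))" for \<psi>
  have eexp_V: "eexp M (\<lambda>\<omega>. U (wealth S w0 \<psi> T \<omega>)) = ereal L - enn2ereal (\<integral>\<^sup>+\<omega>. V (wealth S w0 \<psi> T \<omega>) \<partial>M)"
    if "S \<in> SS" "\<psi> \<in> Adm M F T SS w0" for S \<psi>
  proof -
    have "\<psi> \<in> strategies F T" using that by (auto simp: Adm_def Lpos_def)
    then show ?thesis unfolding V_def using that
      by (intro eexp_eq_diff[OF P Um L(2,1)] wealth_measurable) auto
  qed
  have J_le_L: "J \<psi> \<le> ereal L" if "\<psi> \<in> Adm M F T SS w0" for \<psi>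
  proof -
    \<comment> \<open>The model \<open>R\<close> bounds the infimum; over an empty family it would
      be \<open>\<infinity>\<close>.\<close>
    have "J \<psi> \<le> ereal L - enn2ereal (\<integral>\<^sup>+\<omega>. V (wealth R w0 \<psi> T \<omega>) \<partial>M)"
      unfolding J_def using INF_lower[OF R(1)] eexp_V[OF R(1) that] by metis
    also have "\<dots> \<le> ereal L - 0" by (intro ereal_minus_mono) auto
    finally show ?thesis by simp
  qed
  have J_le: "J \<psi> \<le> J \<phi>" if \<psi>: "\<psi> \<in> Adm M F T SS w0" for \<psi>
    unfolding J_def[of \<phi>]
  proof (rule INF_greatest)
    fix S assume S: "S \<in> SS"
    \<comment> \<open>The worst-case utility is below the utility in each model; the Galois
      connection turns this into one common bound on the costs, which passes to their supremum and,
      by optimality, to every cost of \<open>\<phi>\<close>.\<close>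
    have "(\<integral>\<^sup>+\<omega>. V (wealth S' w0 \<psi> T \<omega>) \<partial>M) \<le> e2ennreal (ereal L - J \<psi>)" if S': "S' \<in> SS" for S'
    proof -
      have "J \<psi> \<le> eexp M (\<lambda>\<omega>. U (wealth S' w0 \<psi> T \<omega>))" unfolding J_def by (rule INF_lower[OF S'])
      then show ?thesis
        unfolding eexp_V[OF S' \<psi>] le_diff_enn2ereal_iff[OF J_le_L[OF \<psi>]] .
    qed
    then have "(SUP S\<in>SS. \<integral>\<^sup>+\<omega>. V (wealth S w0 \<psi> T \<omega>) \<partial>M) \<le> e2ennreal (ereal L - J \<psi>)" by (rule SUP_least)
    moreover have "(\<integral>\<^sup>+\<omega>. V (wealth S w0 \<phi> T \<omega>) \<partial>M) \<le> (SUP S\<in>SS. \<integral>\<^sup>+\<omega>. V (wealth S w0 \<phi> T \<omega>) \<partial>M)"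
      by (rule SUP_upper[OF S])
    ultimately have "(\<integral>\<^sup>+\<omega>. V (wealth S w0 \<phi> T \<omega>) \<partial>M) \<le> e2ennreal (ereal L - J \<psi>)"
      using opt[OF \<psi>] by (meson order_trans)
    then show "J \<psi> \<le> eexp M (\<lambda>\<omega>. U (wealth S w0 \<phi> T \<omega>))"
      unfolding eexp_V[OF S \<phi>] le_diff_enn2ereal_iff[OF J_le_L[OF \<psi>]] .
  qed
  have "uval M F T SS U w0 = J \<phi>"
    unfolding uval_def J_def[symmetric] by (intro antisym SUP_least SUP_upper \<phi> J_le)
  moreover have "J \<phi> < \<infinity>" using J_le_L[OF \<phi>] by (rule le_less_trans) simp
  ultimately show ?thesis using \<phi> unfolding J_def by (intro bexI[of _ \<phi>]) auto
qed

end
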